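(* Let $h$ be a positive even integer and let $f \in M(2,h)$ have Fourier expansion at infinity $f(z) = \sum_{n\ge0} A_n q^n$ with $A_0 \neq 0$. Then $A_n \neq 0$ for some $n$ with $1 \le n \le r(2,h) = \lfloor h/4 \rfloor + 1$.
   Context: $\mathfrak{H}$ is the complex upper half plane, $z \in \mathfrak{H}$, $q = e^{2\pi i z}$. $\Gamma_0(2) = \{\begin{pmatrix} a&b\\c&d\end{pmatrix} \in SL(2,\mathbb{Z}) : c \equiv 0 \pmod 2\}$. $M(2,h)$ denotes the complex vector space of entire (holomorphic on $\mathfrak{H}$ and at the cusps) modular forms of weight $h$ for $\Gamma_0(2)$ with trivial character, and $r(2,h)$ its dimension, which equals $\lfloor h/4\rfloor+1$ for positive even $h$. *)

theory Defs
  imports "HOL-Analysis.Analysis"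
begin

definition upper_half_plane :: "complex set" where
  "upper_half_plane = {z. Im z > 0}"

definition moebius_int :: "int \<Rightarrow> int \<Rightarrow> int \<Rightarrow> int \<Rightarrow> complex \<Rightarrow> complex" where
  "moebius_int a b c d z = (of_int a * z + of_int b) / (of_int c * z + of_int d)"

text \<open>M(2,h): entire modular forms of weight h for Gamma_0(2), trivial character.
  Holomorphy at the cusps: for every gamma in SL(2,Z), the slashed function
  (cz+d)^(-h) f(gamma z) is bounded as Im z tends to infinity.\<close>
definition modular_form_Gamma0_2 :: "nat \<Rightarrow> (complex \<Rightarrow> complex) \<Rightarrow> bool" where
  "modular_form_Gamma0_2 h f \<longleftrightarrow>
     f holomorphic_on upper_half_plane \<and>
     (\<forall>a b c d :: int. a * d - b * c = 1 \<and> even c \<longrightarrow>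
        (\<forall>z \<in> upper_half_plane.
           f (moebius_int a b c d z) = (of_int c * z + of_int d) ^ h * f z)) \<and>
     (\<forall>a b c d :: int. a * d - b * c = 1 \<longrightarrow>
        (\<exists>M y0. \<forall>z. Im z > y0 \<longrightarrow>
           norm (f (moebius_int a b c d z) / (of_int c * z + of_int d) ^ h) \<le> M))"

text \<open>r(2,h), the dimension of M(2,h) for positive even h.\<close>
definition r2 :: "nat \<Rightarrow> nat" where
  "r2 h = h div 4 + 1"

end

(* Suppose A 1, ..., A r all vanish, r = m + 1 with m = h div 4. Multiply f by a form of weight 2 - h that
   is holomorphic on the upper half plane, vanishes at the cusp 0 and has a pole of order r at infinity:
   with the eta quotients X = eta(2z)^16 / eta(z)^8 and J = (eta(z) / eta(2z))^24 take J / X^m when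
   h = 4 m + 2 and J' / X^m when h = 4 m. The product has weight 2 for Gamma_0(2) and no residue at the
   cusp 0, so its constant term at infinity is 0. This constant term is A 0 times the constant term c of
   the multiplier, so it remains to see that c is not 0.

   After q -> -q the coefficients of q^r J / X^m satisfy the recurrence given by its logarithmic
   derivative, whose relevant coefficients are nonnegative except possibly one that is small, so they
   are positive and grow at least by the factor 7. That settles h = 4 m + 2. For h = 4 m, integration
   by parts turns c into a multiple of the constant term of (J / X^m) d log(J X), where the first
   summand dominates.

   The transformation law of eta^8 comes from that of the Eisenstein series E_2, its logarithmic
   derivative. *)

theory Submission
  imports Defs "HOL-Complex_Analysis.Complex_Analysis"
begin

section \<open>Partial fractions of the cotangent\<close>

text \<open>X has weight 4, no zero in the upper half plane or at the cusp 0, and a simple zero at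
  infinity. So division by X^m adjusts the weight in steps of 4 and gives a pole of order m at
  infinity only. J or its derivative adds the last order of the pole and the zero at the cusp 0; the
  derivative also supplies the weight 2 that is missing when h = 4 m. The constant term is shown to
  vanish without a compactified curve: a primitive of the weight 2 form turns out to be periodic,
  and for this only z + 1 and z / (1 - 2 z) matter. The latter is translation by 2 conjugated by
  inversion, so everything reduces to z -> -1/z. Only eighth powers of eta occur, hence inversion
  involves neither square roots nor roots of unity. The obstacle is that the double series behind
  E_2 converges only conditionally: the extra term in its inversion formula is the effect of the
  order of summation. When h = 4 m, the condition m > 0 is essential: for m = 0 the multiplier is an
  exact derivative with constant term 0, and constant functions of weight 0 violate the
  claim.\<close>

lemma has_sum_diff:
  fixes f g :: "'a \<Rightarrow> 'b::topological_ab_group_add"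
  assumes "(f has_sum a) A" "(g has_sum b) A"
  shows "((\<lambda>x. f x - g x) has_sum (a - b)) A"
  using has_sum_add[OF assms(1), of "\<lambda>x. - g x" "- b"] assms(2) by (simp add: has_sum_uminus)

lemma has_sum_int_split:
  fixes f :: "int \<Rightarrow> 'a::topological_ab_group_add"
  assumes "((\<lambda>n::nat. f (int n)) has_sum A) UNIV"
    and "((\<lambda>n::nat. f (- int n - 1)) has_sum B) UNIV"
  shows "(f has_sum (A + B)) UNIV"
proof -
  have "bij_betw int UNIV {0..}"
    by (rule bij_betwI[of _ _ _ nat]) auto
  hence "(f has_sum A) {0..}"
    using assms(1) by (simp add: has_sum_reindex_bij_betw)
  moreover have "bij_betw (\<lambda>n. - int n - 1) UNIV {..<0}"
    by (rule bij_betwI[of _ _ _ "\<lambda>k. nat (- k - 1)"]) auto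
  hence "(f has_sum B) {..<0}"
    using assms(2) by (simp add: has_sum_reindex_bij_betw[where f = f])
  ultimately have "(f has_sum (A + B)) ({0..} \<union> {..<0})"
    by (intro has_sum_Un_disjoint) auto
  also have "{0..} \<union> {..<0} = (UNIV :: int set)" by auto
  finally show ?thesis .
qed

lemma has_sum_nonzero_int_split:
  fixes f :: "int \<Rightarrow> 'a::topological_ab_group_add"
  assumes "((\<lambda>n::nat. f (int n + 1)) has_sum A) UNIV"
    and "((\<lambda>n::nat. f (- int n - 1)) has_sum B) UNIV"
  shows "(f has_sum (A + B)) (- {0})"
proof -
  have "bij_betw (\<lambda>n. int n + 1) UNIV {0<..}"
    by (rule bij_betwI[of _ _ _ "\<lambda>k. nat (k - 1)"]) auto
  hence "(f has_sum A) {0<..}"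
    using assms(1) by (simp add: has_sum_reindex_bij_betw[where f = f])
  moreover have "bij_betw (\<lambda>n. - int n - 1) UNIV {..<0}"
    by (rule bij_betwI[of _ _ _ "\<lambda>k. nat (- k - 1)"]) auto
  hence "(f has_sum B) {..<0}"
    using assms(2) by (simp add: has_sum_reindex_bij_betw[where f = f])
  ultimately have "(f has_sum (A + B)) ({0<..} \<union> {..<0})"
    by (intro has_sum_Un_disjoint) auto
  also have "{0<..} \<union> {..<0} = - {0::int}" by auto
  finally show ?thesis .
qed

lemma has_sum_inverse_square_shift:
  fixes z :: complex
  assumes "z \<noteq> 0"
  shows "((\<lambda>k::nat. 1 / (z + of_nat k)\<^sup>2) has_sum Polygamma 1 z) UNIV"
proof (rule norm_summable_imp_has_sum)
  show "(\<lambda>k. 1 / (z + of_nat k)\<^sup>2) sums Polygamma 1 z"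
    using Polygamma_LIMSEQ[OF assms, of 1] by (simp add: inverse_eq_divide power2_eq_square)
  have "summable (\<lambda>k. 4 * inverse (real k ^ 2))"
    by (intro summable_mult inverse_power_summable) auto
  moreover have "\<forall>\<^sub>F k in sequentially.
      norm (norm (1 / (z + of_nat k)\<^sup>2)) \<le> 4 * inverse (real k ^ 2)"
    using eventually_gt_at_top[of "nat \<lceil>2 * norm z\<rceil>"]
  proof eventually_elim
    case (elim k)
    hence k: "real k > 2 * norm z" "k > 0" by linarith+
    have "real k / 2 \<le> norm (z + of_nat k)"
      using norm_triangle_ineq4[of "z + of_nat k" z] k by auto
    hence "(real k / 2)\<^sup>2 \<le> (norm (z + of_nat k))\<^sup>2" by (intro power_mono) auto
    moreover have "(real k / 2)\<^sup>2 > 0" using k by simp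
    ultimately have "1 / (norm (z + of_nat k))\<^sup>2 \<le> 1 / (real k / 2)\<^sup>2"
      by (intro divide_left_mono mult_pos_pos) auto
    thus ?case by (simp add: norm_divide norm_power field_simps)
  qed
  ultimately show "summable (\<lambda>k. norm (1 / (z + of_nat k)\<^sup>2))"
    by (rule summable_comparison_test_ev[rotated])
qed

text \<open>Logarithmic derivative of the reflection formula, taken for the entire function 1/Gamma
  so that both sides can be differentiated everywhere.\<close>

lemma Digamma_reflection:
  fixes z :: complex
  assumes "z \<notin> \<int>"
  shows "Digamma (1 - z) - Digamma z = of_real pi * cot (of_real pi * z)"
proof -
  have "1 - z \<notin> \<int>" using assms by (metis Ints_1 Ints_diff diff_diff_eq2 add_diff_cancel_left')
  hence z: "z \<notin> \<int>\<^sub>\<le>\<^sub>0" "1 - z \<notin> \<int>\<^sub>\<le>\<^sub>0"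
    using assms nonpos_Ints_Int by blast+
  define G where "G = rGamma z * rGamma (1 - z)"
  have G: "G = sin (of_real pi * z) / of_real pi"
    by (simp add: G_def rGamma_reflection_complex)
  have "G \<noteq> 0" using z by (simp add: G_def rGamma_eq_zero_iff)
  have "((\<lambda>z::complex. rGamma z * rGamma (1 - z)) has_field_derivative
          G * (Digamma (1 - z) - Digamma z)) (at z)"
    using z by (auto intro!: derivative_eq_intros simp: G_def algebra_simps)
  moreover have "((\<lambda>z::complex. rGamma z * rGamma (1 - z)) has_field_derivative
          cos (of_real pi * z)) (at z)"
    unfolding rGamma_reflection_complex by (auto intro!: derivative_eq_intros)
  ultimately have "G * (Digamma (1 - z) - Digamma z) = cos (of_real pi * z)"
    by (rule DERIV_unique)
  thus ?thesis using \<open>G \<noteq> 0\<close> by (simp add: G cot_def field_simps)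
qed

text \<open>Differentiates the reflection formula once more. The left side is the sum of 1/(z + n)^2
  over n >= 0 plus that over n < 0.\<close>

lemma Polygamma_1_reflection:
  fixes z :: complex
  assumes "z \<notin> \<int>"
  shows "Polygamma 1 z + Polygamma 1 (1 - z) = (of_real pi / sin (of_real pi * z))\<^sup>2"
proof -
  have op: "open (- \<int> :: complex set)" by (simp add: closed_Ints open_Compl)
  have "1 - z \<notin> \<int>" using assms by (metis Ints_1 Ints_diff diff_diff_eq2 add_diff_cancel_left')
  hence z: "z \<notin> \<int>\<^sub>\<le>\<^sub>0" "1 - z \<notin> \<int>\<^sub>\<le>\<^sub>0"
    using assms nonpos_Ints_Int by blast+
  have s: "sin (of_real pi * z) \<noteq> 0"
    using assms by (auto simp: sin_eq_0 Ints_def)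
  have "((\<lambda>z::complex. Digamma (1 - z) - Digamma z) has_field_derivative
          - (Polygamma 1 z + Polygamma 1 (1 - z))) (at z)"
    using z by (auto intro!: derivative_eq_intros DERIV_chain2[OF has_field_derivative_Polygamma])
  moreover have "((\<lambda>z::complex. of_real pi * cot (of_real pi * z)) has_field_derivative
          - (of_real pi / sin (of_real pi * z))\<^sup>2) (at z)"
    using s by (auto intro!: derivative_eq_intros DERIV_chain2[OF DERIV_cot]
          simp: field_simps power2_eq_square)
  hence "((\<lambda>z::complex. Digamma (1 - z) - Digamma z) has_field_derivative
          - (of_real pi / sin (of_real pi * z))\<^sup>2) (at z)"
    by (rule has_field_derivative_transform_within_open[OF _ op])
       (use assms Digamma_reflection in auto)
  ultimately have "- (Polygamma 1 z + Polygamma 1 (1 - z)) = - (of_real pi / sin (of_real pi * z))\<^sup>2"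
    by (rule DERIV_unique)
  thus ?thesis by (simp only: neg_equal_iff_equal)
qed

lemma has_sum_inverse_square_int:
  fixes z :: complex
  assumes "z \<notin> \<int>"
  shows "((\<lambda>n::int. 1 / (z + of_int n)\<^sup>2) has_sum (of_real pi / sin (of_real pi * z))\<^sup>2) UNIV"
  unfolding Polygamma_1_reflection[OF assms, symmetric]
proof (rule has_sum_int_split)
  have z: "z \<noteq> 0" "1 - z \<noteq> 0" using assms by auto
  show "((\<lambda>n. 1 / (z + of_int (int n))\<^sup>2) has_sum Polygamma 1 z) UNIV"
    using has_sum_inverse_square_shift[OF z(1)] by simp
  have "(1 - z + of_nat n)\<^sup>2 = (z + of_int (- int n - 1))\<^sup>2" for n
    by (simp add: power2_eq_square algebra_simps)
  thus "((\<lambda>n. 1 / (z + of_int (- int n - 1))\<^sup>2) has_sum Polygamma 1 (1 - z)) UNIV"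
    using has_sum_inverse_square_shift[OF z(2)] by simp
qed

lemma summable_inverse_shift_diff:
  fixes z :: complex
  assumes "z \<notin> \<int>"
  shows "summable (\<lambda>n. norm (1 / (of_nat n + 1 + z) - 1 / (of_nat n + 1)))"
proof -
  have "summable (\<lambda>k. 2 * norm z * inverse (real (Suc k) ^ 2))"
    by (subst summable_Suc_iff, intro summable_mult inverse_power_summable) auto
  moreover have "\<forall>\<^sub>F k in sequentially.
      norm (norm (1 / (of_nat k + 1 + z) - 1 / (of_nat k + 1))) \<le> 2 * norm z * inverse (real (Suc k) ^ 2)"
    using eventually_gt_at_top[of "nat \<lceil>2 * norm z\<rceil>"]
  proof eventually_elim
    case (elim k)
    hence k: "real (Suc k) > 2 * norm z" by linarith
    have n: "norm (of_nat k + 1 :: complex) = real (Suc k)"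
      by (metis norm_of_nat of_nat_Suc add.commute)
    have "real (Suc k) / 2 \<le> norm (of_nat k + 1 + z)"
      using norm_triangle_ineq4[of "of_nat k + 1 + z" z] k n by auto
    hence "real (Suc k) / 2 * real (Suc k) \<le> norm (of_nat k + 1 + z) * real (Suc k)"
      by (intro mult_right_mono) auto
    moreover have nz: "of_nat k + 1 + z \<noteq> 0"
    proof
      assume "of_nat k + 1 + z = 0"
      hence "z = - of_nat (k + 1)" by (simp add: eq_neg_iff_add_eq_0 algebra_simps)
      thus False using assms by auto
    qed
    ultimately have "norm z / (norm (of_nat k + 1 + z) * real (Suc k)) \<le>
        norm z / (real (Suc k) / 2 * real (Suc k))"
      by (intro divide_left_mono) (auto intro!: mult_pos_pos)
    moreover have "norm (1 / (of_nat k + 1 + z) - 1 / (of_nat k + 1))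
        = norm z / (norm (of_nat k + 1 + z) * real (Suc k))"
    proof -
      have "(of_nat k + 1 :: complex) \<noteq> 0" by (metis of_nat_Suc of_nat_neq_0 add.commute)
      hence "1 / (of_nat k + 1 + z) - 1 / (of_nat k + 1) = - z / ((of_nat k + 1 + z) * (of_nat k + 1))"
        using nz by (simp add: divide_simps)
      thus ?thesis using n by (simp add: norm_divide norm_mult)
    qed
    ultimately show ?case by (simp add: power2_eq_square field_simps)
  qed
  ultimately show ?thesis
    by (rule summable_comparison_test_ev[rotated])
qed

lemma has_sum_inverse_shift_diff:
  fixes z :: complex
  assumes "z \<notin> \<int>"
  shows "((\<lambda>n::nat. 1 / (of_nat n + 1 + z) - 1 / (of_nat n + 1)) has_sum
          (- Digamma (1 + z) - euler_mascheroni)) UNIV"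
proof (rule norm_summable_imp_has_sum[OF summable_inverse_shift_diff[OF assms]])
  have "1 + z \<noteq> 0" using assms by (metis Ints_minus Ints_1 add_eq_0_iff minus_minus)
  hence "(\<lambda>n. inverse (of_nat (Suc n)) - inverse (1 + z + of_nat n))
            sums (Digamma (1 + z) + euler_mascheroni)"
    using summable_sums[OF summable_Digamma, of "1 + z"] by (simp add: Digamma_def)
  from sums_minus[OF this] show
    "(\<lambda>n. 1 / (of_nat n + 1 + z) - 1 / (of_nat n + 1)) sums (- Digamma (1 + z) - euler_mascheroni)"
    by (simp add: inverse_eq_divide add_ac minus_diff_commute)
qed

text \<open>The halves n > 0 and n < 0 are Digamma series at 1 + z and 1 - z. Euler's constant
  cancels, and Digamma(1 + z) = Digamma(z) + 1/z accounts for the term 1/z. The subtracted 1/n makes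
  the series absolutely convergent.\<close>

lemma has_sum_cot_partial_fractions:
  fixes z :: complex
  assumes "z \<notin> \<int>"
  shows "((\<lambda>n::int. 1 / (of_int n + z) - 1 / of_int n) has_sum
          (of_real pi * cot (of_real pi * z) - 1 / z)) (- {0})"
proof -
  have mz: "- z \<notin> \<int>" using assms by simp
  have z: "z \<noteq> 0" using assms by auto
  have "((\<lambda>n::int. 1 / (of_int n + z) - 1 / of_int n) has_sum
       ((- Digamma (1 + z) - euler_mascheroni) + - (- Digamma (1 + - z) - euler_mascheroni))) (- {0})"
  proof (rule has_sum_nonzero_int_split)
    show "((\<lambda>n. 1 / (of_int (int n + 1) + z) - 1 / of_int (int n + 1)) has_sum
            - Digamma (1 + z) - euler_mascheroni) UNIV"
      using has_sum_inverse_shift_diff[OF assms] by simp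
    have eq: "1 / (of_int (- int n - 1) + z) - 1 / of_int (- int n - 1) =
          - (1 / (of_nat n + 1 + - z) - 1 / (of_nat n + 1))" for n
    proof -
      have neg: "1 / x = - (1 / y)" if "x = - y" for x y :: complex using that by simp
      have "1 / (of_int (- int n - 1) + z) = - (1 / (of_nat n + 1 + - z))"
        by (rule neg) simp
      moreover have "1 / of_int (- int n - 1) = - (1 / (of_nat n + 1 :: complex))"
        by (rule neg) simp
      ultimately show ?thesis
        by (simp only:) (simp only: minus_diff_eq diff_conv_add_uminus minus_add_distrib minus_minus)
    qed
    show "((\<lambda>n. 1 / (of_int (- int n - 1) + z) - 1 / of_int (- int n - 1)) has_sum
            - (- Digamma (1 + - z) - euler_mascheroni)) UNIV"
      unfolding eq has_sum_uminus minus_minus by (rule has_sum_inverse_shift_diff[OF mz])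
  qed
  also have "((- Digamma (1 + z) - euler_mascheroni) + - (- Digamma (1 + - z) - euler_mascheroni))
      = of_real pi * cot (of_real pi * z) - 1 / z"
    using Digamma_reflection[OF assms] Digamma_plus1[OF z] by (simp add: algebra_simps)
  finally show ?thesis .
qed

section \<open>The order of summation in the Eisenstein series of weight 2\<close>

text \<open>The imaginary part of w = m z + n controls m, and then n = w - m z is controlled as
  well; adding the two bounds gives \<open>K\<close>.\<close>

lemma norm_lattice_ge:
  fixes z :: complex
  assumes "Im z > 0"
  obtains c where "c > 0"
    "\<And>m n :: int. c * (\<bar>real_of_int m\<bar> + \<bar>real_of_int n\<bar>) \<le> norm (of_int m * z + of_int n)"
proof
  define K where "K = 1 / Im z + 1 + norm z / Im z"
  have "K > 0" using assms by (simp add: K_def add_pos_nonneg add_pos_pos)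
  thus "1 / K > 0" by simp
  fix m n :: int
  define w where "w = of_int m * z + of_int n"
  have "\<bar>Im w\<bar> \<le> norm w" by (rule abs_Im_le_cmod)
  hence m: "\<bar>real_of_int m\<bar> \<le> norm w / Im z"
    using assms by (simp add: w_def abs_mult field_simps)
  have "norm (of_int n :: complex) \<le> norm w + norm (of_int m * z)"
    using norm_triangle_ineq4[of w "of_int m * z"] by (simp add: w_def)
  also have "norm (of_int m * z) = \<bar>real_of_int m\<bar> * norm z"
    by (simp add: norm_mult)
  also have "\<dots> \<le> norm w / Im z * norm z" using m by (rule mult_right_mono) auto
  finally have "\<bar>real_of_int m\<bar> + \<bar>real_of_int n\<bar> \<le> norm w * K"
    using m by (simp add: K_def algebra_simps)
  thus "1 / K * (\<bar>real_of_int m\<bar> + \<bar>real_of_int n\<bar>) \<le> norm (of_int m * z + of_int n)"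
    using \<open>K > 0\<close> by (simp add: w_def field_simps)
qed

lemma summable_on_powr_nat: "(\<lambda>n::nat. (real n + 1) powr (-3/2)) summable_on UNIV"
proof (rule summable_nonneg_imp_summable_on)
  have "summable (\<lambda>n. real (Suc n) powr (-3/2))"
    by (subst summable_Suc_iff) (simp add: summable_real_powr_iff)
  thus "summable (\<lambda>n. (real n + 1) powr (-3/2))" by (simp add: add_ac)
qed simp

lemma summable_on_powr_int: "(\<lambda>n::int. (1 + \<bar>real_of_int n\<bar>) powr (-3/2)) summable_on UNIV"
proof -
  obtain S where S: "((\<lambda>n::nat. (real n + 1) powr (-3/2)) has_sum S) UNIV"
    using summable_on_powr_nat by (auto simp: summable_on_def)
  have "summable (\<lambda>n. real (n + 2) powr (-3/2))"
    by (rule summable_ignore_initial_segment) (simp add: summable_real_powr_iff)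
  hence "(\<lambda>n. real (n + 2) powr (-3/2)) summable_on UNIV"
    by (intro summable_nonneg_imp_summable_on) auto
  then obtain S' where S': "((\<lambda>n::nat. (2 + real n) powr (-3/2)) has_sum S') UNIV"
    by (auto simp: summable_on_def add_ac)
  have "((\<lambda>n::int. (1 + \<bar>real_of_int n\<bar>) powr (-3/2)) has_sum (S + S')) UNIV"
  proof (rule has_sum_int_split)
    show "((\<lambda>n. (1 + \<bar>real_of_int (int n)\<bar>) powr (- 3 / 2)) has_sum S) UNIV"
      using S by (simp add: add_ac)
    have "1 + \<bar>real_of_int (- int n - 1)\<bar> = 2 + real n" for n by simp
    thus "((\<lambda>n. (1 + \<bar>real_of_int (- int n - 1)\<bar>) powr (- 3 / 2)) has_sum S') UNIV"
      using S' by simp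
  qed
  thus ?thesis by (auto simp: summable_on_def)
qed

text \<open>Since 1 + |m| + |n| is at least 1 + |m| and at least 1 + |n|, the exponent 3 can be
  shared equally between two convergent one-dimensional series of exponent 3/2.\<close>

lemma summable_on_lattice_powr:
  "(\<lambda>(m, n). (\<bar>real_of_int m\<bar> + \<bar>real_of_int n\<bar> + 1) powr (-3)) summable_on (UNIV :: (int \<times> int) set)"
proof (rule summable_on_comparison_test)
  let ?p = "\<lambda>n::int. (1 + \<bar>real_of_int n\<bar>) powr (-3/2)"
  obtain S where S: "(?p has_sum S) UNIV"
    using summable_on_powr_int by (auto simp: summable_on_def)
  have "(\<lambda>x. ?p (fst x) * ?p (snd x)) summable_on (Sigma UNIV (\<lambda>_. UNIV))"
  proof (rule summable_on_SigmaI)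
    show "((\<lambda>y. ?p (fst (x, y)) * ?p (snd (x, y))) has_sum (?p x * S)) UNIV" for x
      using has_sum_cmult_right[OF S, of "?p x"] by simp
    show "(\<lambda>x. ?p x * S) summable_on UNIV"
      by (rule summable_on_cmult_left[OF summable_on_powr_int])
  qed auto
  thus "(\<lambda>(m, n). ?p m * ?p n) summable_on UNIV" by (simp add: case_prod_unfold)
  fix x :: "int \<times> int"
  obtain m n where x: "x = (m, n)" by (cases x)
  define s where "s = \<bar>real_of_int m\<bar> + \<bar>real_of_int n\<bar> + 1"
  have "s powr (-3) = s powr (-3/2) * s powr (-3/2)"
    unfolding powr_add[symmetric] by simp
  also have "\<dots> \<le> ?p m * ?p n"
    by (intro mult_mono powr_mono2') (auto simp: s_def)
  finally show "(case x of (m, n) \<Rightarrow> (\<bar>real_of_int m\<bar> + \<bar>real_of_int n\<bar> + 1) powr (-3))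
      \<le> (case x of (m, n) \<Rightarrow> ?p m * ?p n)"
    by (simp add: x s_def)
qed (auto split: prod.splits)

lemma lattice_nonzero:
  fixes z :: complex and m n :: int
  assumes "Im z > 0" "m \<noteq> 0"
  shows "of_int m * z + of_int n \<noteq> 0"
  using assms by (auto simp: complex_eq_iff)

text \<open>With w = m z + n the difference is 1/(w^2 (w + 1)). Its cubic decay suffices on a
  lattice of rank 2, while the quadratic decay of each term alone does not.\<close>

lemma summable_on_eisenstein_diff:
  fixes z :: complex
  assumes "Im z > 0"
  shows "(\<lambda>(m, n). 1 / (of_int m * z + of_int n)\<^sup>2 -
            1 / ((of_int m * z + of_int n) * (of_int m * z + of_int n + 1)))
         summable_on ((- {0}) \<times> (UNIV :: int set))"
proof -
  obtain c where c: "c > 0" and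
    cb: "\<And>m n :: int. c * (\<bar>real_of_int m\<bar> + \<bar>real_of_int n\<bar>) \<le> norm (of_int m * z + of_int n)"
    using norm_lattice_ge[OF assms] by blast
  show ?thesis
  proof (rule abs_summable_summable, rule summable_on_comparison_test)
    show "(\<lambda>(m, n). (3 / c) ^ 3 * (\<bar>real_of_int m\<bar> + \<bar>real_of_int n\<bar> + 1) powr (-3))
            summable_on ((- {0}) \<times> (UNIV :: int set))"
      using summable_on_cmult_right[OF summable_on_subset[OF summable_on_lattice_powr subset_UNIV],
          of "(3 / c) ^ 3" "(- {0}) \<times> UNIV"]
      by (simp add: case_prod_unfold)
    fix x :: "int \<times> int" assume "x \<in> (- {0}) \<times> UNIV"
    then obtain m n where x: "x = (m, n)" and m: "m \<noteq> 0" by (cases x) auto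
    define w where "w = of_int m * z + of_int n"
    define s where "s = \<bar>real_of_int m\<bar> + \<bar>real_of_int n\<bar> + 1"
    have s: "s > 0" by (simp add: s_def)
    have m1: "\<bar>real_of_int m\<bar> \<ge> 1" using m by linarith
    have w0: "w \<noteq> 0" "w + 1 \<noteq> 0"
      using lattice_nonzero[OF assms m, of n] lattice_nonzero[OF assms m, of "n + 1"]
      by (simp_all add: w_def add_ac)
    \<comment> \<open>As |m| >= 1, both |m| + |n| and |m| + |n + 1| are at least
      \<open>s / 3\<close>; this uses that the row m = 0 is left out.\<close>
    have w1: "c / 3 * s \<le> norm w"
    proof -
      have "c / 3 * s \<le> c * (\<bar>real_of_int m\<bar> + \<bar>real_of_int n\<bar>)"
        using c m1 by (simp add: s_def)
      thus ?thesis using cb[of m n] by (simp add: w_def)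
    qed
    have w2: "c / 3 * s \<le> norm (w + 1)"
    proof -
      have "c / 3 * s \<le> c * (\<bar>real_of_int m\<bar> + \<bar>real_of_int (n + 1)\<bar>)"
      proof -
        have "s \<le> 3 * (\<bar>real_of_int m\<bar> + \<bar>real_of_int (n + 1)\<bar>)"
        proof -
          have *: "p \<ge> 1 \<Longrightarrow> q - 1 \<le> r \<Longrightarrow> r \<ge> 0 \<Longrightarrow> p + q + 1 \<le> 3 * p + 3 * r" for p q r :: real
            by linarith
          show ?thesis unfolding s_def distrib_left using m1 by (rule *) auto
        qed
        from mult_left_mono[OF this, of "c / 3"] show ?thesis using c by simp
      qed
      thus ?thesis using cb[of m "n + 1"] by (simp add: w_def add_ac)
    qed
    have cs: "c / 3 * s > 0" using c s by simp
    have "1 / w\<^sup>2 - 1 / (w * (w + 1)) = 1 / (w\<^sup>2 * (w + 1))"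
      using w0 by (simp add: divide_simps power2_eq_square)
    hence "norm (1 / w\<^sup>2 - 1 / (w * (w + 1))) = 1 / ((norm w)\<^sup>2 * norm (w + 1))"
      by (simp add: norm_divide norm_mult norm_power)
    also have "\<dots> \<le> 1 / ((c / 3 * s)\<^sup>2 * (c / 3 * s))"
      using w1 w2 cs c s w0 by (intro divide_left_mono mult_mono power_mono mult_pos_pos) auto
    also have "\<dots> = (3 / c) ^ 3 * s powr (-3)"
      using s c by (simp add: powr_minus divide_simps power2_eq_square power3_eq_cube)
    finally show "norm (case x of (m, n) \<Rightarrow> 1 / (of_int m * z + of_int n)\<^sup>2 -
              1 / ((of_int m * z + of_int n) * (of_int m * z + of_int n + 1)))
       \<le> (case x of (m, n) \<Rightarrow> (3 / c) ^ 3 * (\<bar>real_of_int m\<bar> + \<bar>real_of_int n\<bar> + 1) powr (-3))"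
      by (simp add: x w_def s_def)
  qed auto
qed

section \<open>Telescoping sums over the integers and the limits of the cotangent\<close>

lemma has_sum_int_imp_symmetric_limit:
  fixes f :: "int \<Rightarrow> 'a::{topological_space, comm_monoid_add}"
  assumes "(f has_sum S) UNIV"
  shows "(\<lambda>N. \<Sum>n\<in>{- int N..<int N}. f n) \<longlonglongrightarrow> S"
proof -
  have "filterlim (\<lambda>N. {- int N..<int N}) (finite_subsets_at_top UNIV) sequentially"
    unfolding filterlim_finite_subsets_at_top
  proof (intro allI impI)
    fix X :: "int set" assume X: "finite X \<and> X \<subseteq> UNIV"
    define M where "M = Max (insert 0 (abs ` X))"
    have M: "\<bar>x\<bar> \<le> M" if "x \<in> X" for x using X that by (auto simp: M_def)
    have "M \<ge> 0" using X by (auto simp: M_def)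
    show "\<forall>\<^sub>F N in sequentially. finite {- int N..<int N} \<and> X \<subseteq> {- int N..<int N} \<and>
        {- int N..<int N} \<subseteq> UNIV"
      using eventually_gt_at_top[of "nat M"]
    proof eventually_elim
      case (elim N)
      have "x \<in> {- int N..<int N}" if "x \<in> X" for x
        using M[OF that] elim \<open>M \<ge> 0\<close> by auto
      thus ?case by auto
    qed
  qed
  with assms show ?thesis unfolding has_sum_def by (rule filterlim_compose)
qed

lemma sum_int_telescope:
  fixes g :: "int \<Rightarrow> 'a::ab_group_add"
  shows "(\<Sum>n\<in>{- int N..<int N}. g n - g (n + 1)) = g (- int N) - g (int N)"
proof (induction N)
  case (Suc N)
  have "{- int (Suc N)..<int (Suc N)} = insert (- int N - 1) (insert (int N) {- int N..<int N})"
    by auto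
  hence "(\<Sum>n\<in>{- int (Suc N)..<int (Suc N)}. g n - g (n + 1))
       = (g (- int N - 1) - g (- int N)) + ((g (int N) - g (int N + 1)) + (g (- int N) - g (int N)))"
    using Suc by simp
  also have "\<dots> = g (- int N - 1) - g (int N + 1)" by simp
  also have "- int N - 1 = - int (Suc N)" by simp
  also have "int N + 1 = int (Suc N)" by simp
  finally show ?case .
qed simp

text \<open>The two ends may have different limits, and their difference is what later becomes the
  defect. Summability lets the symmetric partial sums determine the unordered sum.\<close>

lemma has_sum_int_telescope:
  fixes g :: "int \<Rightarrow> 'a::{topological_ab_group_add, t2_space}"
  assumes "(\<lambda>n. g n - g (n + 1)) summable_on UNIV"
    and "(\<lambda>N. g (- int N)) \<longlonglongrightarrow> A" and "(\<lambda>N. g (int N)) \<longlonglongrightarrow> B"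
  shows "((\<lambda>n. g n - g (n + 1)) has_sum (A - B)) UNIV"
proof -
  obtain S where S: "((\<lambda>n. g n - g (n + 1)) has_sum S) UNIV"
    using assms(1) by (auto simp: summable_on_def)
  have "(\<lambda>N. g (- int N) - g (int N)) \<longlonglongrightarrow> S"
    using has_sum_int_imp_symmetric_limit[OF S] by (simp add: sum_int_telescope)
  moreover have "(\<lambda>N. g (- int N) - g (int N)) \<longlonglongrightarrow> A - B"
    using assms(2,3) by (rule tendsto_diff)
  ultimately have "S = A - B" by (rule LIMSEQ_unique)
  thus ?thesis using S by simp
qed

lemma exp_neg_2pi_i_upper:
  assumes "Im z > 0"
  shows "norm (exp (2 * of_real pi * \<i> * z)) < 1"
  using assms by (simp add: norm_exp_eq_Re)

text \<open>Written with exp(-2 i x), which is small when Im x tends to minus infinity; the limit i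
  can be read off.\<close>

lemma cot_conv_exp:
  fixes x :: complex
  assumes "exp (- 2 * \<i> * x) \<noteq> 1"
  shows "cot x = \<i> * (1 + exp (- 2 * \<i> * x)) / (1 - exp (- 2 * \<i> * x))"
proof -
  define e where "e = exp (\<i> * x)"
  have e: "e \<noteq> 0" by (simp add: e_def)
  have inv: "exp (- (\<i> * x)) = 1 / e" by (simp add: e_def exp_minus inverse_eq_divide)
  have "- 2 * \<i> * x = - (\<i> * x) + - (\<i> * x)" by simp
  hence sq: "exp (- 2 * \<i> * x) = 1 / e\<^sup>2"
    by (simp only: exp_add inv) (simp add: power2_eq_square)
  have ne: "e\<^sup>2 \<noteq> 1" using assms unfolding sq by auto
  show ?thesis
    unfolding cot_def sin_exp_eq cos_exp_eq sq inv e_def [symmetric]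
    using e ne by (simp add: divide_simps power2_eq_square)
qed

text \<open>As 1/z lies in the lower half plane, exp(-2 pi i N/z) is the N-th power of a number of
  modulus less than 1.\<close>

lemma cot_limit_lattice:
  fixes z :: complex
  assumes "Im z > 0"
  shows "(\<lambda>N. cot (of_real pi * (of_nat N / z))) \<longlonglongrightarrow> \<i>"
proof -
  define r where "r = exp (2 * of_real pi * \<i> * (- 1 / z))"
  have r: "norm r < 1"
    unfolding r_def using assms by (intro exp_neg_2pi_i_upper) (simp add: Im_divide sum_power2_gt_zero_iff)
  have rn: "r ^ N \<noteq> 1" if "N > 0" for N
  proof
    assume "r ^ N = 1"
    hence "norm r ^ N = 1" by (metis norm_one norm_power)
    thus False using power_strict_mono[OF r norm_ge_zero that] by simp
  qed
  have "(\<lambda>N. \<i> * (1 + r ^ N) / (1 - r ^ N)) \<longlonglongrightarrow> \<i> * (1 + 0) / (1 - 0)"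
    using r by (intro tendsto_intros LIMSEQ_power_zero) auto
  moreover have "\<forall>\<^sub>F N in sequentially.
      \<i> * (1 + r ^ N) / (1 - r ^ N) = cot (of_real pi * (of_nat N / z))"
    using eventually_gt_at_top[of 0]
  proof eventually_elim
    case (elim N)
    have "exp (- 2 * \<i> * (of_real pi * (of_nat N / z))) = r ^ N"
      unfolding r_def exp_of_nat_mult [symmetric] by (simp add: mult_ac)
    thus ?case using cot_conv_exp[of "of_real pi * (of_nat N / z)"] rn[OF elim] by simp
  qed
  ultimately show ?thesis by (simp add: tendsto_cong)
qed

lemma lattice_quotient_notin_Ints:
  fixes z :: complex and n :: int
  assumes "Im z > 0" "n \<noteq> 0"
  shows "of_int n / z \<notin> \<int>" "of_int n * z \<notin> \<int>"
proof -
  have z: "z \<noteq> 0" using assms by auto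
  have "Im (of_int n / z) \<noteq> 0" using assms z by (auto simp: Im_divide sum_power2_eq_zero_iff complex_eq_iff)
  thus "of_int n / z \<notin> \<int>" by (auto elim!: Ints_cases)
  have "Im (of_int n * z) \<noteq> 0" using assms by auto
  thus "of_int n * z \<notin> \<int>" by (metis Ints_cases complex_Im_of_int)
qed

lemma has_sum_inverse_squares_nonzero_int:
  "((\<lambda>n::int. 1 / (of_int n)\<^sup>2 :: complex) has_sum (of_real pi)\<^sup>2 / 3) (- {0})"
proof -
  have "((\<lambda>n::nat. 1 / (real n + 1)\<^sup>2) has_sum pi\<^sup>2 / 6) UNIV"
    by (rule sums_nonneg_imp_has_sum) (use inverse_squares_sums in \<open>auto simp: add_ac\<close>)
  hence *: "((\<lambda>n::nat. 1 / (of_nat n + 1)\<^sup>2 :: complex) has_sum of_real (pi\<^sup>2 / 6)) UNIV"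
    by (subst (asm) has_sum_of_real_iff [symmetric, where 'a = complex]) simp
  have sq: "(of_int (- int n - 1) :: complex)\<^sup>2 = (of_nat n + 1)\<^sup>2" for n
    by (simp add: power2_eq_square algebra_simps)
  have "((\<lambda>n::int. 1 / (of_int n)\<^sup>2 :: complex) has_sum
           (of_real (pi\<^sup>2 / 6) + of_real (pi\<^sup>2 / 6))) (- {0})"
    by (rule has_sum_nonzero_int_split) (use * in \<open>simp_all only: sq\<close>, simp)
  thus ?thesis by simp
qed

text \<open>Summing $(mz+n)^{-2}$, $m \neq 0$, by rows and by columns gives different results; the
  telescoping double series of $1/((mz+n)(mz+n+1))$ has the same defect and differs from it by an
  absolutely convergent series.\<close>

lemma eisenstein_order_defect:
  fixes z :: complex
  assumes z: "Im z > 0"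
    and rows: "((\<lambda>m::int. (of_real pi / sin (of_real pi * (of_int m * z)))\<^sup>2) has_sum T) (- {0})"
    and cols: "((\<lambda>n::int. (of_real pi / sin (of_real pi * (of_int n / z)))\<^sup>2) has_sum T') (- {0})"
  shows "T = (of_real pi)\<^sup>2 / 3 / z\<^sup>2 + T' / z\<^sup>2 - (of_real pi)\<^sup>2 / 3 + 2 * of_real pi * \<i> / z"
proof -
  define a where "a = (\<lambda>m n :: int. 1 / ((of_int m * z + of_int n) * (of_int m * z + of_int n + 1)))"
  define b where "b = (\<lambda>m n :: int. 1 / (of_int m * z + of_int n)\<^sup>2)"
  have z0: "z \<noteq> 0" using z by auto
  have nz: "of_int m * z + of_int n \<noteq> 0" if "m \<noteq> 0" for m n :: int
    using lattice_nonzero[OF z that] .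
  have nz1: "of_int m * z + of_int n + 1 \<noteq> 0" if "m \<noteq> 0" for m n :: int
    using lattice_nonzero[OF z that, of "n + 1"] by (simp add: add_ac)

  have sum: "(\<lambda>(m, n). b m n - a m n) summable_on ((- {0}) \<times> UNIV)"
    using summable_on_eisenstein_diff[OF z] by (simp add: a_def b_def)
  then obtain I where I: "((\<lambda>(m, n). b m n - a m n) has_sum I) ((- {0}) \<times> UNIV)"
    by (auto simp: summable_on_def)

  have row: "((\<lambda>n. b m n - a m n) has_sum (of_real pi / sin (of_real pi * (of_int m * z)))\<^sup>2) UNIV"
    if m: "m \<noteq> 0" for m
  proof -
    \<comment> \<open>Along a row \<open>a\<close> telescopes, and \<open>g\<close> tends to 0 at
      both ends. So subtracting \<open>a\<close> leaves the row sums of \<open>b\<close>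
      unchanged.\<close>
    define g where "g = (\<lambda>n::int. 1 / (of_int m * z + of_int n))"
    have b: "((\<lambda>n. b m n) has_sum (of_real pi / sin (of_real pi * (of_int m * z)))\<^sup>2) UNIV"
      unfolding b_def by (rule has_sum_inverse_square_int) (rule lattice_quotient_notin_Ints[OF z m])
    have "(\<lambda>n. b m n - a m n) summable_on UNIV"
      using summable_on_SigmaD1[OF sum, of m] m by simp
    hence "(\<lambda>n. b m n - (b m n - a m n)) summable_on UNIV"
      using b has_sum_diff unfolding summable_on_def by fast
    moreover have ag: "a m n = g n - g (n + 1)" for n
      using nz[OF m, of n] nz1[OF m, of n]
      by (simp add: a_def g_def divide_simps add.assoc)
    ultimately have sg: "(\<lambda>n. g n - g (n + 1)) summable_on UNIV" by simp
    have "(\<lambda>N. g (int N)) \<longlonglongrightarrow> 0" "(\<lambda>N. g (- int N)) \<longlonglongrightarrow> 0"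
    proof -
      have lim: "(\<lambda>N. inverse (w + of_nat N)) \<longlonglongrightarrow> 0" for w :: complex
        by (intro filterlim_compose[OF tendsto_inverse_0]
            tendsto_add_filterlim_at_infinity[OF tendsto_const] tendsto_of_nat)
      show "(\<lambda>N. g (int N)) \<longlonglongrightarrow> 0"
        using lim[of "of_int m * z"] by (simp add: g_def inverse_eq_divide)
      have "g (- int N) = - inverse (- (of_int m * z) + of_nat N)" for N
      proof -
        have "of_int m * z + of_int (- int N) = - (- (of_int m * z) + of_nat N)" by simp
        thus ?thesis by (simp only: g_def inverse_minus_eq inverse_eq_divide [symmetric])
      qed
      thus "(\<lambda>N. g (- int N)) \<longlonglongrightarrow> 0"
        using tendsto_minus[OF lim[of "- (of_int m * z)"]] by simp
    qed
    from has_sum_int_telescope[OF sg this(2,1)] have "((\<lambda>n. a m n) has_sum 0) UNIV"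
      by (simp add: ag)
    from has_sum_diff[OF b this] show ?thesis by simp
  qed
  have "((\<lambda>m. (of_real pi / sin (of_real pi * (of_int m * z)))\<^sup>2) has_sum I) (- {0})"
    by (rule has_sum_SigmaD[OF I]) (use row in auto)
  hence IT: "I = T" using rows has_sum_unique by blast

  \<comment> \<open>\<open>C n\<close> is the column sum of 1/(m + n/z) - 1/m; the terms 1/m force
    convergence and cancel in \<open>C n - C (n + 1)\<close>. \<open>B n\<close> is the column sum
    of \<open>b\<close>: for n = 0 it is a multiple of the sum of 1/m^2, otherwise the term 1/n^2 of
    m = 0 is removed from the sum over all m.\<close>
  define C where "C = (\<lambda>n::int. if n = 0 then 0
    else of_real pi * cot (of_real pi * (of_int n / z)) - 1 / (of_int n / z))"
  define B where "B = (\<lambda>n::int. if n = 0 then (of_real pi)\<^sup>2 / 3 / z\<^sup>2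
    else (of_real pi / sin (of_real pi * (of_int n / z)))\<^sup>2 / z\<^sup>2 - 1 / (of_int n)\<^sup>2)"
  have C: "((\<lambda>m::int. 1 / (of_int m + of_int n / z) - 1 / of_int m) has_sum C n) (- {0})" for n
  proof (cases "n = 0")
    case False
    thus ?thesis
      using has_sum_cot_partial_fractions[OF lattice_quotient_notin_Ints(1)[OF z False]]
      by (simp add: C_def)
  qed (simp add: C_def)
  have col_a: "((\<lambda>m. a m n) has_sum (C n - C (n + 1)) / z) (- {0})" for n
  proof -
    have "((\<lambda>m::int. 1 / z * ((1 / (of_int m + of_int n / z) - 1 / of_int m) -
            (1 / (of_int m + of_int (n + 1) / z) - 1 / of_int m))) has_sum 1 / z * (C n - C (n + 1))) (- {0})"
      by (intro has_sum_cmult_right has_sum_diff C)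
    moreover have "1 / z * ((1 / (of_int m + of_int n / z) - 1 / of_int m) -
            (1 / (of_int m + of_int (n + 1) / z) - 1 / of_int m)) = a m n" if "m \<noteq> 0" for m
    proof -
      have "1 / z * (1 / (of_int m + w / z)) = 1 / (of_int m * z + w)" for w
        using z0 by (simp add: field_simps)
      hence "1 / z * ((1 / (of_int m + of_int n / z) - 1 / of_int m) -
            (1 / (of_int m + of_int (n + 1) / z) - 1 / of_int m)) =
          1 / (of_int m * z + of_int n) - 1 / (of_int m * z + of_int (n + 1))"
        by (simp add: right_diff_distrib del: of_int_add)
      also have "\<dots> = a m n"
        using nz[OF that, of n] nz1[OF that, of n]
        by (simp add: a_def divide_simps add.assoc)
      finally show ?thesis .
    qed
    ultimately show ?thesis by (subst (asm) has_sum_cong) auto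
  qed
  have col_b: "((\<lambda>m. b m n) has_sum B n) (- {0})" for n
  proof (cases "n = 0")
    case True
    have "((\<lambda>m::int. 1 / (of_int m)\<^sup>2 * (1 / z\<^sup>2)) has_sum (of_real pi)\<^sup>2 / 3 * (1 / z\<^sup>2)) (- {0})"
      by (intro has_sum_cmult_left has_sum_inverse_squares_nonzero_int)
    thus ?thesis using True by (simp add: b_def B_def power_mult_distrib)
  next
    case False
    have "((\<lambda>m::int. 1 / (of_int n / z + of_int m)\<^sup>2 * (1 / z\<^sup>2)) has_sum
            (of_real pi / sin (of_real pi * (of_int n / z)))\<^sup>2 * (1 / z\<^sup>2)) UNIV"
      by (intro has_sum_cmult_left has_sum_inverse_square_int lattice_quotient_notin_Ints z False)
    moreover have "1 / (of_int n / z + of_int m)\<^sup>2 * (1 / z\<^sup>2) = b m n" for m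
    proof -
      have "of_int m * z + of_int n = (of_int n / z + of_int m) * z" using z0 by (simp add: field_simps)
      thus ?thesis by (simp add: b_def power_mult_distrib)
    qed
    ultimately have "((\<lambda>m. b m n) has_sum
        (of_real pi / sin (of_real pi * (of_int n / z)))\<^sup>2 / z\<^sup>2) UNIV"
      by simp
    moreover have "((\<lambda>m. b m n) has_sum b 0 n) {0}"
      using has_sum_finite[of "{0}" "\<lambda>m. b m n"] by simp
    ultimately have "((\<lambda>m. b m n) has_sum
        ((of_real pi / sin (of_real pi * (of_int n / z)))\<^sup>2 / z\<^sup>2 - b 0 n)) (UNIV - {0})"
      by (rule has_sum_Diff) auto
    thus ?thesis using False by (simp add: b_def B_def Compl_eq_Diff_UNIV)
  qed
  have "((\<lambda>n. B n - (C n - C (n + 1)) / z) has_sum I) UNIV"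
  proof (rule has_sum_SigmaD)
    show "((\<lambda>(n, m). b m n - a m n) has_sum I) (UNIV \<times> (- {0}))"
      using I by (subst has_sum_swap) simp
    show "((\<lambda>m. case (n, m) of (n, m) \<Rightarrow> b m n - a m n) has_sum B n - (C n - C (n + 1)) / z) (- {0})" for n
      using has_sum_diff[OF col_b col_a] by simp
  qed
  moreover have B: "(B has_sum ((of_real pi)\<^sup>2 / 3 / z\<^sup>2 + (T' / z\<^sup>2 - (of_real pi)\<^sup>2 / 3))) UNIV"
  proof -
    have "((\<lambda>n::int. (of_real pi / sin (of_real pi * (of_int n / z)))\<^sup>2 * (1 / z\<^sup>2) - 1 / (of_int n)\<^sup>2) has_sum
             (T' * (1 / z\<^sup>2) - (of_real pi)\<^sup>2 / 3)) (- {0})"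
      by (intro has_sum_diff has_sum_cmult_left cols has_sum_inverse_squares_nonzero_int)
    hence "(B has_sum (T' / z\<^sup>2 - (of_real pi)\<^sup>2 / 3)) (- {0})"
      by (subst has_sum_cong[where g = "\<lambda>n::int. (of_real pi / sin (of_real pi * (of_int n / z)))\<^sup>2 * (1 / z\<^sup>2) - 1 / (of_int n)\<^sup>2"])
         (auto simp: B_def)
    hence "(B has_sum (B 0 + (T' / z\<^sup>2 - (of_real pi)\<^sup>2 / 3))) (insert 0 (- {0}))"
      by (intro has_sum_insert) auto
    also have "insert 0 (- {0}) = (UNIV :: int set)" by auto
    finally show ?thesis by (simp add: B_def)
  qed
  ultimately have "((\<lambda>n. B n - (B n - (C n - C (n + 1)) / z)) has_sum
      ((of_real pi)\<^sup>2 / 3 / z\<^sup>2 + (T' / z\<^sup>2 - (of_real pi)\<^sup>2 / 3)) - I) UNIV"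
    by (intro has_sum_diff)
  moreover have "B n - (B n - (C n - C (n + 1)) / z) = C n / z - C (n + 1) / z" for n
    by (simp add: diff_divide_distrib)
  ultimately have S: "((\<lambda>n. C n / z - C (n + 1) / z) has_sum
      ((of_real pi)\<^sup>2 / 3 / z\<^sup>2 + (T' / z\<^sup>2 - (of_real pi)\<^sup>2 / 3)) - I) UNIV"
    by simp
  \<comment> \<open>Here the defect arises: \<open>C\<close> is odd with limit pi i, so the columns
    of \<open>a\<close> add up to -2 pi i/z, whereas its rows add up to 0.\<close>
  have C1: "(\<lambda>N. C (int N)) \<longlonglongrightarrow> of_real pi * \<i>"
  proof -
    have "(\<lambda>N. of_real pi * cot (of_real pi * (of_nat N / z)) - z * (1 / of_nat N)) \<longlonglongrightarrow>
             of_real pi * \<i> - z * 0"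
      by (intro tendsto_intros cot_limit_lattice z lim_1_over_n)
    thus ?thesis
      by (rule Lim_transform_eventually[OF _ eventually_mono[OF eventually_gt_at_top[of 0]], THEN tendsto_eq_rhs])
         (auto simp: C_def)
  qed
  have "C (- n) = - C n" for n
    by (simp add: C_def cot_def)
  hence C2: "(\<lambda>N. C (- int N)) \<longlonglongrightarrow> - (of_real pi * \<i>)"
    using tendsto_minus[OF C1] by simp
  have "(\<lambda>n. C n / z - C (n + 1) / z) summable_on UNIV"
    using S unfolding summable_on_def by blast
  from has_sum_int_telescope[where g = "\<lambda>n. C n / z", OF this
      tendsto_divide[OF C2 tendsto_const z0] tendsto_divide[OF C1 tendsto_const z0]]
  have "((\<lambda>n. C n / z - C (n + 1) / z) has_sum (- (of_real pi * \<i>) / z - of_real pi * \<i> / z)) UNIV" .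
  from has_sum_unique[OF this S] show ?thesis
    by (simp add: IT algebra_simps)
qed

section \<open>The eighth power of the eta function\<close>

definition divisor_sum :: "nat \<Rightarrow> nat" where
  "divisor_sum n = (\<Sum>d | d dvd n. d)"

text \<open>The value at 0 is 0, because the divisors of 0 form an infinite set.\<close>

lemma divisor_sum_0 [simp]: "divisor_sum 0 = 0"
  by (simp add: divisor_sum_def)

definition sigma_fps :: "complex fps" where
  "sigma_fps = Abs_fps (\<lambda>n. of_nat (divisor_sum n))"

section \<open>Lambert series and divisor sums\<close>

lemma has_sum_nat_ge_1_iff:
  fixes f :: "nat \<Rightarrow> 'a::{topological_space, comm_monoid_add}"
  shows "(f has_sum S) {1..} \<longleftrightarrow> ((\<lambda>n. f (Suc n)) has_sum S) UNIV"
proof -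
  have "bij_betw Suc UNIV {1..}"
    by (rule bij_betwI[of _ _ _ "\<lambda>n. n - 1"]) auto
  from has_sum_reindex_bij_betw[OF this, of f S] show ?thesis by simp
qed

lemma has_sum_geometric_deriv:
  fixes z :: "'a::{real_normed_field, banach}"
  assumes "norm z < 1"
  shows "((\<lambda>d. of_nat d * z ^ d) has_sum z / (1 - z)\<^sup>2) {1..}"
proof -
  have "(\<lambda>n. of_nat (Suc n) * norm z ^ n) sums (1 / (1 - norm z)\<^sup>2)"
    by (rule geometric_deriv_sums) (use assms in simp)
  hence "summable (\<lambda>n. norm (of_nat (Suc n) * z ^ n))"
    by (simp add: sums_iff norm_mult norm_power del: of_nat_Suc)
  hence "((\<lambda>n. of_nat (Suc n) * z ^ n) has_sum (1 / (1 - z)\<^sup>2)) UNIV"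
    by (rule norm_summable_imp_has_sum) (rule geometric_deriv_sums[OF assms])
  from has_sum_cmult_right[OF this, of z] show ?thesis
    unfolding has_sum_nat_ge_1_iff by (simp add: mult_ac del: of_nat_Suc)
qed

lemma norm_power_Suc_less_1:
  fixes q :: "'a::real_normed_div_algebra"
  assumes "norm q < 1" "n \<ge> 1"
  shows "norm (q ^ n) < 1"
  using power_strict_mono[OF assms(1) norm_ge_zero, of n] assms(2) by (simp add: norm_power)

text \<open>Summation over d gives r^n/(1 - r^n)^2, which is dominated by a geometric series because
  1 - r^n >= 1 - r.\<close>

lemma summable_on_lambert:
  fixes r :: real
  assumes "0 \<le> r" "r < 1"
  shows "(\<lambda>(n, d). real d * r ^ (n * d)) summable_on ({1..} \<times> {1..})"
proof (rule summable_on_SigmaI)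
  show "((\<lambda>d. case (n, d) of (n, d) \<Rightarrow> real d * r ^ (n * d)) has_sum r ^ n / (1 - r ^ n)\<^sup>2) {1..}"
    if "n \<in> {1..}" for n
    using has_sum_geometric_deriv[of "r ^ n"] norm_power_Suc_less_1[of r n] that assms
    by (simp add: power_mult)
  have "summable (\<lambda>n. r ^ n * (r / (1 - r)\<^sup>2))"
    using assms by (intro summable_mult2 summable_geometric) auto
  hence "(\<lambda>n. r ^ n * (r / (1 - r)\<^sup>2)) summable_on UNIV"
    using assms by (intro summable_nonneg_imp_summable_on) auto
  hence "(\<lambda>n. r ^ Suc n / (1 - r ^ Suc n)\<^sup>2) summable_on UNIV"
  proof (rule summable_on_comparison_test)
    fix n
    have "r ^ Suc n \<le> r" using assms by (simp add: mult_left_le power_le_one)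
    hence "(1 - r)\<^sup>2 \<le> (1 - r ^ Suc n)\<^sup>2" using assms by (intro power_mono) auto
    moreover have "(1 - r)\<^sup>2 > 0" using assms by simp
    ultimately have "r ^ Suc n / (1 - r ^ Suc n)\<^sup>2 \<le> r ^ Suc n / (1 - r)\<^sup>2"
      using assms by (intro divide_left_mono mult_pos_pos) auto
    thus "r ^ Suc n / (1 - r ^ Suc n)\<^sup>2 \<le> r ^ n * (r / (1 - r)\<^sup>2)" by (simp add: mult_ac)
  qed (use assms in auto)
  thus "(\<lambda>n. r ^ n / (1 - r ^ n)\<^sup>2) summable_on {1..}"
    unfolding summable_on_def has_sum_nat_ge_1_iff .
qed (use assms in auto)

text \<open>Both series are rearrangements of the double series of d q^(n d): summed over d for
  fixed n, or grouped by the product N = n d.\<close>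

lemma has_sum_lambert_divisor:
  fixes q :: complex
  assumes "norm q < 1"
  obtains S where "((\<lambda>n. q ^ n / (1 - q ^ n)\<^sup>2) has_sum S) {1..}"
    and "(\<lambda>n. of_nat (divisor_sum n) * q ^ n) sums S"
proof -
  have "(\<lambda>(n, d). of_nat d * q ^ (n * d)) summable_on ({1..} \<times> {1..})"
  proof (rule abs_summable_summable)
    have "norm (case x of (n, d) \<Rightarrow> of_nat d * q ^ (n * d)) =
         (case x of (n, d) \<Rightarrow> real d * norm q ^ (n * d))" for x :: "nat \<times> nat"
      by (cases x) (simp add: norm_mult norm_power)
    thus "(\<lambda>x. norm (case x of (n, d) \<Rightarrow> of_nat d * q ^ (n * d))) summable_on ({1..} \<times> {1..})"
      using summable_on_lambert[of "norm q"] assms by simp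
  qed
  then obtain S where S: "((\<lambda>(n, d). of_nat d * q ^ (n * d)) has_sum S) ({1..} \<times> {1..})"
    by (auto simp: summable_on_def)
  have 1: "((\<lambda>n. q ^ n / (1 - q ^ n)\<^sup>2) has_sum S) {1..}"
  proof (rule has_sum_SigmaD[OF S])
    show "((\<lambda>d. case (n, d) of (n, d) \<Rightarrow> of_nat d * q ^ (n * d)) has_sum q ^ n / (1 - q ^ n)\<^sup>2) {1..}"
      if "n \<in> {1..}" for n
      using has_sum_geometric_deriv[of "q ^ n"] norm_power_Suc_less_1[OF assms, of n] that
      by (simp add: power_mult)
  qed
  have bij: "bij_betw (\<lambda>(N, d :: nat). (N div d, d)) (SIGMA N:{1..}. {d. d dvd N}) ({1..} \<times> {1..})"
  proof (rule bij_betwI[of _ _ _ "\<lambda>(n, d). (n * d, d)"])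
    show "(\<lambda>(N, d :: nat). (N div d, d)) \<in> (SIGMA N:{1..}. {d. d dvd N}) \<rightarrow> {1..} \<times> {1..}"
    proof -
      have "1 \<le> N div d \<and> 1 \<le> d" if N: "1 \<le> N" and "d dvd N" for N d :: nat
      proof -
        obtain k where "N = d * k" using \<open>d dvd N\<close> by blast
        thus ?thesis using N by (cases "d = 0"; cases "k = 0") auto
      qed
      thus ?thesis by auto
    qed
  qed (auto simp: Suc_le_eq)
  have "((\<lambda>(N, d). of_nat d * q ^ N) has_sum S) (SIGMA N:{1..}. {d. d dvd N})"
    using has_sum_reindex_bij_betw[OF bij, of "\<lambda>(n, d). of_nat d * q ^ (n * d)" S] S
    by (subst has_sum_cong[where g = "\<lambda>x. case (case x of (N, d) \<Rightarrow> (N div d, d)) of (n, d) \<Rightarrow> of_nat d * q ^ (n * d)"])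
       auto
  hence "((\<lambda>N. of_nat (divisor_sum N) * q ^ N) has_sum S) {1..}"
  proof (rule has_sum_SigmaD)
    show "((\<lambda>d. case (N, d) of (N, d) \<Rightarrow> of_nat d * q ^ N) has_sum of_nat (divisor_sum N) * q ^ N) {d. d dvd N}"
      if "N \<in> {1..}" for N
      using that by (intro has_sum_finiteI) (auto simp: divisor_sum_def sum_distrib_right)
  qed
  \<comment> \<open>The index 0 has to stay out of the regrouping, but can be added now since
    \<open>divisor_sum 0\<close> is 0.\<close>
  moreover have "((\<lambda>N. of_nat (divisor_sum N) * q ^ N) has_sum S) {1..} \<longleftrightarrow>
      ((\<lambda>N. of_nat (divisor_sum N) * q ^ N) has_sum S) UNIV"
    by (rule has_sum_cong_neutral) (auto simp: not_le)
  ultimately have "((\<lambda>N. of_nat (divisor_sum N) * q ^ N) has_sum S) UNIV" by simp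
  hence 2: "(\<lambda>n. of_nat (divisor_sum n) * q ^ n) sums S"
    by (rule has_sum_imp_sums)
  show ?thesis using 1 2 by (rule that)
qed

lemma fps_conv_radius_sigma: "fps_conv_radius sigma_fps \<ge> 1"
  unfolding fps_conv_radius_def sigma_fps_def
proof (rule conv_radius_geI_ex')
  fix r :: real assume "0 < r" "ereal r < 1"
  hence "norm (of_real r :: complex) < 1" by simp
  from has_sum_lambert_divisor[OF this] obtain S
    where "(\<lambda>n. of_nat (divisor_sum n) * (of_real r :: complex) ^ n) sums S" .
  thus "summable (\<lambda>n. fps_nth (Abs_fps (\<lambda>n. of_nat (divisor_sum n))) n * (of_real r :: complex) ^ n)"
    by (simp add: sums_iff)
qed

lemma norm_less_conv_radius_sigma: "norm q < 1 \<Longrightarrow> ereal (norm q) < fps_conv_radius sigma_fps"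
  using fps_conv_radius_sigma by (rule less_le_trans[rotated]) simp

lemma has_sum_lambert_eval_sigma:
  fixes q :: complex
  assumes "norm q < 1"
  shows "((\<lambda>n. q ^ Suc n / (1 - q ^ Suc n)\<^sup>2) has_sum eval_fps sigma_fps q) UNIV"
proof -
  obtain S where S: "((\<lambda>n. q ^ n / (1 - q ^ n)\<^sup>2) has_sum S) {1..}"
    "(\<lambda>n. of_nat (divisor_sum n) * q ^ n) sums S"
    using has_sum_lambert_divisor[OF assms] .
  have "S = eval_fps sigma_fps q"
    using sums_eval_fps[OF norm_less_conv_radius_sigma[OF assms]] S(2)
    by (simp add: sigma_fps_def sums_iff)
  thus ?thesis using S(1) unfolding has_sum_nat_ge_1_iff by simp
qed

section \<open>Inversion of the Eisenstein series of weight 2\<close>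

definition nome :: "complex \<Rightarrow> complex" where
  "nome z = exp (2 * of_real pi * \<i> * z)"

lemma norm_nome_less_1: "Im z > 0 \<Longrightarrow> norm (nome z) < 1"
  by (simp add: nome_def exp_neg_2pi_i_upper)

lemma inverse_sin_square_conv_nome:
  assumes "nome x \<noteq> 1"
  shows "(of_real pi / sin (of_real pi * x))\<^sup>2 = -4 * (of_real pi)\<^sup>2 * (nome x / (1 - nome x)\<^sup>2)"
proof -
  define e where "e = exp (\<i> * (of_real pi * x))"
  have e: "e \<noteq> 0" by (simp add: e_def)
  have inv: "exp (- (\<i> * (of_real pi * x))) = 1 / e" by (simp add: e_def exp_minus inverse_eq_divide)
  have "2 * of_real pi * \<i> * x = \<i> * (of_real pi * x) + \<i> * (of_real pi * x)" by simp
  hence sq: "nome x = e\<^sup>2"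
    by (simp only: nome_def exp_add e_def power2_eq_square)
  have s: "sin (of_real pi * x) = (e\<^sup>2 - 1) / (2 * \<i> * e)"
    unfolding sin_exp_eq inv e_def [symmetric] using e by (simp add: field_simps power2_eq_square)
  have "e\<^sup>2 - 1 \<noteq> 0" "1 - e\<^sup>2 \<noteq> 0" using assms by (auto simp: sq)
  moreover have "(e\<^sup>2 - 1)\<^sup>2 = (1 - e\<^sup>2)\<^sup>2" by (simp add: power2_commute)
  ultimately show ?thesis
    unfolding s sq using e by (simp add: power_divide power_mult_distrib)
qed

text \<open>The term of m > 0 is -4 pi^2 q^m/(1 - q^m)^2, a Lambert summand; m and -m contribute
  equally, whence the factor 8.\<close>

lemma has_sum_inverse_sin_square:
  fixes z :: complex
  assumes "Im z > 0"
  shows "((\<lambda>m::int. (of_real pi / sin (of_real pi * (of_int m * z)))\<^sup>2) has_sum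
           (-8 * (of_real pi)\<^sup>2 * eval_fps sigma_fps (nome z))) (- {0})"
proof -
  let ?f = "\<lambda>m::int. (of_real pi / sin (of_real pi * (of_int m * z)))\<^sup>2"
  let ?S = "-4 * (of_real pi)\<^sup>2 * eval_fps sigma_fps (nome z)"
  note q = norm_nome_less_1[OF assms]
  have f: "?f (int n + 1) = -4 * (of_real pi)\<^sup>2 * (nome z ^ Suc n / (1 - nome z ^ Suc n)\<^sup>2)" for n
  proof -
    have nn: "nome (of_int (int n + 1) * z) = nome z ^ Suc n"
      unfolding nome_def exp_of_nat_mult [symmetric] by (simp add: mult_ac add_ac)
    have "norm (nome z ^ Suc n) < 1" by (rule norm_power_Suc_less_1[OF q]) simp
    hence "nome (of_int (int n + 1) * z) \<noteq> 1" unfolding nn by auto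
    from inverse_sin_square_conv_nome[OF this] show ?thesis by (simp only: nn)
  qed
  have 1: "((\<lambda>n. ?f (int n + 1)) has_sum ?S) UNIV"
    unfolding f by (intro has_sum_cmult_right has_sum_lambert_eval_sigma q)
  have "?f (- int n - 1) = ?f (int n + 1)" for n
  proof -
    have "of_real pi * (of_int (- int n - 1) * z) = - (of_real pi * (of_int (int n + 1) * z))"
      by (simp add: algebra_simps)
    thus ?thesis by (simp only: sin_minus power_divide power2_minus)
  qed
  hence "((\<lambda>n. ?f (- int n - 1)) has_sum ?S) UNIV" using 1 by simp
  from has_sum_nonzero_int_split[OF 1 this] show ?thesis by (simp add: mult_ac)
qed

text \<open>The sums \<open>T\<close> and \<open>T'\<close> of
  \<open>eisenstein_order_defect\<close> are the divisor series at z and at -1/z. The factor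
  \<open>K\<close> clears the constants, and the term 6 z/(pi i) is what remains of the
  defect.\<close>

lemma eisenstein_E2_inversion:
  fixes z :: complex
  assumes "Im z > 0"
  shows "1 - 24 * eval_fps sigma_fps (nome (- 1 / z)) =
           z\<^sup>2 * (1 - 24 * eval_fps sigma_fps (nome z)) + 6 * z / (of_real pi * \<i>)"
proof -
  have z: "z \<noteq> 0" using assms by auto
  have "Im (- 1 / z) > 0" using assms by (simp add: Im_divide sum_power2_gt_zero_iff)
  note has_sum_inverse_sin_square[OF this]
  moreover have "(of_real pi / sin (of_real pi * (of_int m * (- 1 / z))))\<^sup>2 =
       (of_real pi / sin (of_real pi * (of_int m / z)))\<^sup>2" for m :: int
    by (simp add: power_divide)
  ultimately have "((\<lambda>m::int. (of_real pi / sin (of_real pi * (of_int m / z)))\<^sup>2) has_sum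
           (-8 * (of_real pi)\<^sup>2 * eval_fps sigma_fps (nome (- 1 / z)))) (- {0})"
    by simp
  note eq = eisenstein_order_defect[OF assms has_sum_inverse_sin_square[OF assms] this]
  define p where "p = (of_real pi :: complex)"
  define a b where "a = eval_fps sigma_fps (nome (- 1 / z))" and "b = eval_fps sigma_fps (nome z)"
  have p: "p \<noteq> 0" by (simp add: p_def)
  define K where "K = 3 * z\<^sup>2 / p\<^sup>2"
  have "-8 * p\<^sup>2 * b * K = (p\<^sup>2 / 3 / z\<^sup>2 + -8 * p\<^sup>2 * a / z\<^sup>2 - p\<^sup>2 / 3 + 2 * p * \<i> / z) * K"
    using eq by (simp only: p_def a_def b_def)
  moreover have "-8 * p\<^sup>2 * b * K = -24 * z\<^sup>2 * b" "p\<^sup>2 / 3 / z\<^sup>2 * K = 1"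
    "-8 * p\<^sup>2 * a / z\<^sup>2 * K = -24 * a" "p\<^sup>2 / 3 * K = z\<^sup>2" "2 * p * \<i> / z * K = 6 * z * \<i> / p"
    using p z by (simp_all add: K_def power2_eq_square)
  ultimately have "-24 * z\<^sup>2 * b = 1 + -24 * a - z\<^sup>2 + 6 * z * \<i> / p"
    by (simp only: distrib_right left_diff_distrib)
  moreover have "6 * z / (p * \<i>) = - (6 * z * \<i> / p)"
    using p by (simp add: divide_simps)
  ultimately show ?thesis
    unfolding a_def [symmetric] b_def [symmetric] p_def [symmetric] by (simp add: algebra_simps)
qed

text \<open>These are the coefficients of -log of the product of all 1 - q^n; at n = 0 the quotient
  0/0 is 0. Starting from the logarithm makes all powers of the product available and nonzero at
  once, with termwise logarithmic derivative.\<close>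

definition log_euler_fps :: "complex fps" where
  "log_euler_fps = Abs_fps (\<lambda>n. of_nat (divisor_sum n) / of_nat n)"

lemma fps_X_mult_deriv_log_euler: "fps_X * fps_deriv log_euler_fps = sigma_fps"
proof (rule fps_ext)
  show "fps_nth (fps_X * fps_deriv log_euler_fps) n = fps_nth sigma_fps n" for n
    by (cases n) (simp_all add: log_euler_fps_def sigma_fps_def del: of_nat_Suc)
qed

lemma fps_conv_radius_log_euler: "fps_conv_radius log_euler_fps \<ge> 1"
  unfolding fps_conv_radius_def
proof (rule conv_radius_geI_ex')
  fix r :: real assume r: "0 < r" "ereal r < 1"
  have "summable (\<lambda>n. norm (fps_nth sigma_fps n * of_real r ^ n))"
    using r by (intro norm_summable_fps norm_less_conv_radius_sigma) auto
  thus "summable (\<lambda>n. fps_nth log_euler_fps n * of_real r ^ n)"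
  proof (rule summable_comparison_test'[where N = 1])
    fix n :: nat assume "n \<ge> 1"
    hence "real (divisor_sum n) / real n \<le> real (divisor_sum n)"
      by (simp add: divide_le_eq mult_le_cancel_left1)
    thus "norm (fps_nth log_euler_fps n * of_real r ^ n) \<le> norm (fps_nth sigma_fps n * of_real r ^ n)"
      using mult_right_mono[of _ _ "norm (of_real r ^ n :: complex)"]
      by (simp only: log_euler_fps_def sigma_fps_def norm_mult norm_divide fps_nth_Abs_fps norm_of_nat norm_ge_zero)
  qed
qed

lemma norm_less_conv_radius_log_euler:
  "norm q < 1 \<Longrightarrow> ereal (norm q) < fps_conv_radius log_euler_fps"
  using fps_conv_radius_log_euler by (rule less_le_trans[rotated]) simp

text \<open>Minus the logarithm of Euler's product $\prod (1 - q^n)$.\<close>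

definition log_euler :: "complex \<Rightarrow> complex" where
  "log_euler = eval_fps log_euler_fps"

lemma has_field_derivative_log_euler:
  assumes "norm q < 1"
  shows "(log_euler has_field_derivative eval_fps (fps_deriv log_euler_fps) q) (at q)"
  unfolding log_euler_def
  by (rule has_field_derivative_eval_fps) (rule norm_less_conv_radius_log_euler[OF assms])

lemma mult_deriv_log_euler:
  assumes "norm q < 1"
  shows "q * eval_fps (fps_deriv log_euler_fps) q = eval_fps sigma_fps q"
proof -
  have "ereal (norm q) < fps_conv_radius (fps_deriv log_euler_fps)"
    using norm_less_conv_radius_log_euler[OF assms] fps_conv_radius_deriv by (rule less_le_trans)
  from eval_fps_mult[OF _ this, of fps_X] show ?thesis
    by (simp add: fps_X_mult_deriv_log_euler)
qed

lemma log_euler_holomorphic [holomorphic_intros]: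
  "f holomorphic_on A \<Longrightarrow> (\<And>z. z \<in> A \<Longrightarrow> norm (f z) < 1) \<Longrightarrow> (\<lambda>z. log_euler (f z)) holomorphic_on A"
proof -
  assume f: "f holomorphic_on A" "\<And>z. z \<in> A \<Longrightarrow> norm (f z) < 1"
  have "log_euler holomorphic_on ball 0 1"
    unfolding log_euler_def
    by (rule holomorphic_on_eval_fps) (use norm_less_conv_radius_log_euler in auto)
  moreover have "f ` A \<subseteq> ball 0 1" using f(2) by auto
  ultimately show ?thesis using holomorphic_on_compose_gen[OF f(1)] by (simp add: o_def)
qed

lemma log_euler_0 [simp]: "log_euler 0 = 0"
  by (simp add: log_euler_def eval_fps_at_0 log_euler_fps_def)

text \<open>This is eta(z)^8 = q^(1/3) times the eighth power of Euler's product, with q^(1/3) read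
  as exp(2 pi i z/3). The exponent 8 turns the factor (-i z)^(1/2) in the inversion of eta into
  z^4.\<close>

definition eta8 :: "complex \<Rightarrow> complex" where
  "eta8 z = exp (2 * of_real pi * \<i> * z / 3 - 8 * log_euler (nome z))"

lemma eta8_nonzero [simp]: "eta8 z \<noteq> 0"
  by (simp add: eta8_def)

lemma has_field_derivative_nome:
  "(nome has_field_derivative (2 * of_real pi * \<i> * nome z)) (at z)"
  unfolding nome_def by (auto intro!: derivative_eq_intros)

lemma has_field_derivative_eta8:
  assumes "Im z > 0"
  shows "(eta8 has_field_derivative
           eta8 z * (2 * of_real pi * \<i> / 3 * (1 - 24 * eval_fps sigma_fps (nome z)))) (at z)"
proof -
  note q = norm_nome_less_1[OF assms]
  have "((\<lambda>z. log_euler (nome z)) has_field_derivative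
          eval_fps (fps_deriv log_euler_fps) (nome z) * (2 * of_real pi * \<i> * nome z)) (at z)"
    by (rule DERIV_chain2[OF has_field_derivative_log_euler[OF q] has_field_derivative_nome])
  also have "eval_fps (fps_deriv log_euler_fps) (nome z) * (2 * of_real pi * \<i> * nome z) =
      2 * of_real pi * \<i> * eval_fps sigma_fps (nome z)"
    by (simp add: mult_deriv_log_euler[OF q, symmetric] mult_ac)
  finally have "((\<lambda>z. exp (2 * of_real pi * \<i> * z / 3 - 8 * log_euler (nome z))) has_field_derivative
     exp (2 * of_real pi * \<i> * z / 3 - 8 * log_euler (nome z)) *
     (2 * of_real pi * \<i> / 3 - 8 * (2 * of_real pi * \<i> * eval_fps sigma_fps (nome z)))) (at z)"
    by (auto intro!: derivative_eq_intros)
  thus ?thesis by (simp add: eta8_def [abs_def] algebra_simps)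
qed

lemma Im_inversion_pos: "Im z > 0 \<Longrightarrow> Im (- 1 / z) > 0"
  by (simp add: Im_divide sum_power2_gt_zero_iff)

text \<open>By the formula for E_2 both sides have the same logarithmic derivative, so their
  quotient is constant. It is 1 at i, which inversion fixes and where z^4 = 1.\<close>

lemma eta8_inversion:
  assumes z: "Im z > 0"
  shows "eta8 (- 1 / z) = z ^ 4 * eta8 z"
proof -
  define G where "G = (\<lambda>z. eta8 (- 1 / z) / (z ^ 4 * eta8 z))"
  have "(G has_field_derivative 0) (at z within {z. Im z > 0})" if "z \<in> {z. Im z > 0}" for z
  proof -
    have z: "Im z > 0" using that by simp
    have z0: "z \<noteq> 0" using z by auto
    define a b where "a = 1 - 24 * eval_fps sigma_fps (nome (- 1 / z))"
      and "b = 1 - 24 * eval_fps sigma_fps (nome z)"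
    define k where "k = 2 * of_real pi * \<i> / 3"
    have ab: "a = z\<^sup>2 * b + 4 * z / k"
      using eisenstein_E2_inversion[OF z] by (simp add: a_def b_def k_def)
    have "((\<lambda>z. - 1 / z) has_field_derivative 1 / z\<^sup>2) (at z)"
      using z0 by (auto intro!: derivative_eq_intros simp: power2_eq_square)
    from DERIV_chain2[OF has_field_derivative_eta8[OF Im_inversion_pos[OF z]] this]
    have d1: "((\<lambda>z. eta8 (- 1 / z)) has_field_derivative eta8 (- 1 / z) * (k * a) * (1 / z\<^sup>2)) (at z)"
      by (simp add: a_def k_def)
    have d2: "(eta8 has_field_derivative eta8 z * (k * b)) (at z)"
      using has_field_derivative_eta8[OF z] by (simp add: b_def k_def)
    have d3: "((\<lambda>z. z ^ 4 * eta8 z) has_field_derivative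
        (4 * z ^ 3 * eta8 z + z ^ 4 * (eta8 z * (k * b)))) (at z)"
      by (auto intro!: derivative_eq_intros d2)
    have "(G has_field_derivative
        (eta8 (- 1 / z) * (k * a) * (1 / z\<^sup>2) * (z ^ 4 * eta8 z) -
         eta8 (- 1 / z) * (4 * z ^ 3 * eta8 z + z ^ 4 * (eta8 z * (k * b)))) / (z ^ 4 * eta8 z)\<^sup>2) (at z)"
      unfolding G_def power2_eq_square [of "z ^ 4 * eta8 z"]
      using z0 by (intro DERIV_divide d1 d3) auto
    moreover have "eta8 (- 1 / z) * (k * a) * (1 / z\<^sup>2) * (z ^ 4 * eta8 z) =
        eta8 (- 1 / z) * (4 * z ^ 3 * eta8 z + z ^ 4 * (eta8 z * (k * b)))"
    proof -
      have "k \<noteq> 0" by (simp add: k_def)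
      hence "k * a * (1 / z\<^sup>2) * z ^ 4 = 4 * z ^ 3 + z ^ 4 * (k * b)"
        using z0 by (simp add: ab field_simps power2_eq_square power3_eq_cube power4_eq_xxxx)
      hence "eta8 (- 1 / z) * eta8 z * (k * a * (1 / z\<^sup>2) * z ^ 4) =
          eta8 (- 1 / z) * eta8 z * (4 * z ^ 3 + z ^ 4 * (k * b))" by simp
      thus ?thesis by (simp add: algebra_simps)
    qed
    ultimately show ?thesis by (simp add: has_field_derivative_at_within)
  qed
  hence "\<exists>c. \<forall>z\<in>{z. Im z > 0}. G z = c"
    by (intro has_field_derivative_zero_constant convex_halfspace_Im_gt)
  then obtain c where c: "\<And>z. Im z > 0 \<Longrightarrow> G z = c" by auto
  have "G \<i> = 1" by (simp add: G_def power4_eq_xxxx)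
  hence "G z = 1" using c[of \<i>] c[OF z] by simp
  moreover have "z ^ 4 * eta8 z \<noteq> 0" using z by auto
  ultimately show ?thesis by (simp add: G_def)
qed

section \<open>Coefficients of eta quotients\<close>

text \<open>A crude bound made for comparison with coefficients growing by the factor 7: the powers
  of 3/7 from the first on sum to only 3/4.\<close>

lemma divisor_sum_le_power_3:
  assumes "n \<ge> 1"
  shows "divisor_sum n \<le> 3 ^ (n - 1)"
proof -
  have "divisor_sum n \<le> \<Sum>{..n}"
    unfolding divisor_sum_def using assms by (intro sum_mono2) (auto dest: dvd_imp_le)
  also have "\<Sum>{..n} \<le> 3 ^ (n - 1)"
    using assms
  proof (induction n rule: dec_induct)
    case (step n)
    have "Suc k + 1 \<le> 2 * 3 ^ k" for k :: nat by (induction k) auto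
    from this[of "n - 1"] have "n + 1 \<le> 2 * 3 ^ (n - 1)" using step(1) by simp
    moreover have "3 ^ (Suc n - 1) = (3 * 3 ^ (n - 1) :: nat)"
      using step(1) by (cases n) auto
    ultimately show ?case using step(3) by simp
  qed (auto simp: atMost_Suc)
  finally show ?thesis .
qed

text \<open>An odd divisor of 2 n divides n, an even one is twice a divisor of n. It serves to keep
  recurrence coefficients of even index nonnegative.\<close>

lemma divisor_sum_double_le:
  assumes "n \<ge> 1"
  shows "divisor_sum (2 * n) \<le> 3 * divisor_sum n"
proof -
  let ?D = "{d. d dvd n}"
  have fin: "finite ?D" using assms by simp
  have "{d. d dvd 2 * n} \<subseteq> ?D \<union> (*) 2 ` ?D"
  proof
    fix d assume d: "d \<in> {d. d dvd 2 * n}"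
    show "d \<in> ?D \<union> (*) 2 ` ?D"
    proof (cases "even d")
      case True
      thus ?thesis using d by (auto elim!: evenE)
    next
      case False
      hence "coprime d 2" by simp
      thus ?thesis using d by (simp add: coprime_dvd_mult_right_iff)
    qed
  qed
  hence "divisor_sum (2 * n) \<le> \<Sum>(?D \<union> (*) 2 ` ?D)"
    unfolding divisor_sum_def using fin by (intro sum_mono2) auto
  also have "\<dots> \<le> \<Sum>?D + \<Sum>((*) 2 ` ?D)"
    using sum_Un_nat[of ?D "(*) 2 ` ?D" id] fin by simp
  also have "\<Sum>((*) 2 ` ?D) = 2 * \<Sum>?D"
    by (subst sum.reindex) (auto simp: inj_on_def sum_distrib_left)
  finally show ?thesis by (simp add: divisor_sum_def)
qed

text \<open>The series \<open>sigma_fps\<close> with q replaced by q^2.\<close>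

definition sigma2_fps :: "complex fps" where
  "sigma2_fps = Abs_fps (\<lambda>n. if even n then of_nat (divisor_sum (n div 2)) else 0)"

text \<open>The sign (-1)^n is multiplicative along the Cauchy product. Because \<open>C\<close> is
  real, the recurrence passes to real parts, so that \<open>W\<close> need not be shown to be real;
  a nonzero real part is enough in the end.\<close>

lemma alternating_fps_mult_nth:
  fixes W C :: "complex fps"
  assumes "\<And>i. fps_nth C i = of_real (c i)"
  shows "Re ((-1) ^ n * fps_nth (C * W) n) =
         (\<Sum>i\<le>n. (-1) ^ i * c i * Re ((-1) ^ (n - i) * fps_nth W (n - i)))"
proof -
  have Re: "Re (of_real x * z) = x * Re z" for x z by simp
  have "(-1) ^ n * fps_nth (C * W) n =
        (\<Sum>i\<le>n. of_real ((-1) ^ i * c i) * ((-1) ^ (n - i) * fps_nth W (n - i)))"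
    unfolding fps_mult_nth sum_distrib_left atLeast0AtMost
  proof (rule sum.cong)
    fix i assume "i \<in> {..n}"
    hence "(-1 :: complex) ^ n = (-1) ^ i * (-1) ^ (n - i)"
      by (simp flip: power_add)
    thus "(-1) ^ n * (fps_nth C i * fps_nth W (n - i)) =
        of_real ((-1) ^ i * c i) * ((-1) ^ (n - i) * fps_nth W (n - i))"
      by (simp add: assms mult_ac)
  qed simp
  also have "Re \<dots> = (\<Sum>i\<le>n. (-1) ^ i * c i * Re ((-1) ^ (n - i) * fps_nth W (n - i)))"
    using Re by (simp only: Re_sum)
  finally show ?thesis .
qed

text \<open>The term a 1 = 24 + 8 m drives the growth. Among the indices up to m + 1 only a 2 = 8 m
  - 24 can be negative; by induction it costs at most 24 p(n - 1) <= (24/7) p n, and 24 + 8 m - 24/7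
  >= 7 (n + 1) for n <= m.\<close>

lemma eta_quotient_coeff_growth:
  fixes p a :: "nat \<Rightarrow> real" and m :: nat
  assumes p0: "p 0 = 1"
    and a: "\<And>N. a N = (if odd N then (24 + 8 * m) * divisor_sum N
              else (48 + 32 * real m) * divisor_sum (N div 2) - (24 + 8 * real m) * divisor_sum N)"
    and rec: "\<And>n. real n * p n = (\<Sum>i\<le>n. a i * p (n - i))"
  shows "n \<le> m \<Longrightarrow> p n > 0 \<and> p (Suc n) \<ge> 7 * p n"
proof (induction n rule: less_induct)
  case (less n)
  have a0: "a 0 = 0" by (simp add: a)
  have a1: "a 1 = 24 + 8 * real m" by (simp add: a divisor_sum_def)
  have "divisor_sum 2 \<le> 3" using divisor_sum_le_power_3[of 2] by simp
  moreover have "divisor_sum 1 = 1" by (simp add: divisor_sum_def)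
  ultimately have a2: "a 2 \<ge> -24"
    using mult_left_mono[of "real (divisor_sum 2)" 3 "24 + 8 * real m"] by (simp add: a)
  \<comment> \<open>An even k >= 3 is at least 4, so k <= n + 1 <= m + 1 forces m >= 3, and then 3
    (24 + 8 m) <= 48 + 32 m.\<close>
  have a3: "a k \<ge> 0" if "k \<ge> 3" "k \<le> Suc n" for k
  proof (cases "odd k")
    case False
    then obtain j where j: "k = 2 * j" by (auto elim!: evenE)
    have "j \<ge> 2" using that j by simp
    hence "m \<ge> 3" "j \<ge> 1" using that less.prems j by linarith+
    have "real (divisor_sum k) \<le> 3 * real (divisor_sum j)"
      using divisor_sum_double_le[OF \<open>j \<ge> 1\<close>] unfolding j by linarith
    hence "(24 + 8 * real m) * divisor_sum k \<le> (24 + 8 * real m) * (3 * divisor_sum j)"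
      by (intro mult_left_mono) auto
    also have "\<dots> \<le> (48 + 32 * real m) * divisor_sum j"
    proof -
      have "(24 + 8 * real m) * 3 \<le> 48 + 32 * real m" using \<open>m \<ge> 3\<close> by simp
      from mult_right_mono[OF this, of "real (divisor_sum j)"] show ?thesis by (simp add: mult_ac)
    qed
    finally show ?thesis by (simp add: a j)
  qed (simp add: a)
  have pos: "p k > 0" if "k \<le> n" for k
  proof (cases "k = n")
    case True
    show ?thesis
    proof (cases n)
      case (Suc n')
      hence "p n' > 0 \<and> p (Suc n') \<ge> 7 * p n'" using less.IH[of n'] less.prems by simp
      thus ?thesis using Suc True by auto
    qed (use True p0 in auto)
  qed (use less that in auto)
  have "real (Suc n) * p (Suc n) \<ge> (24 + 8 * real m) * p n - 24 / 7 * p n"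
  proof (cases n)
    case 0
    have "real (Suc n) * p (Suc n) = a 1 * p 0"
      using rec[of "Suc n"] 0 a0 by simp
    thus ?thesis using 0 a1 by (simp add: p0)
  next
    case (Suc n')
    have "{..Suc n} = {0, 1, 2} \<union> {3..Suc n}" using Suc by auto
    hence "real (Suc n) * p (Suc n) = (\<Sum>i\<in>{0, 1, 2} \<union> {3..Suc n}. a i * p (Suc n - i))"
      using rec[of "Suc n"] by simp
    also have "\<dots> = (\<Sum>i\<in>{0, 1, 2}. a i * p (Suc n - i)) + (\<Sum>i\<in>{3..Suc n}. a i * p (Suc n - i))"
      by (rule sum.union_disjoint) auto
    also have "(\<Sum>i\<in>{0, 1, 2}. a i * p (Suc n - i)) = a 1 * p n + a 2 * p n'"
      using Suc a0 by (simp add: numeral_2_eq_2)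
    finally have "real (Suc n) * p (Suc n) =
      a 1 * p n + a 2 * p n' + (\<Sum>i\<in>{3..Suc n}. a i * p (Suc n - i))" .
    moreover have "(\<Sum>i\<in>{3..Suc n}. a i * p (Suc n - i)) \<ge> 0"
      by (intro sum_nonneg mult_nonneg_nonneg a3 less_imp_le[OF pos]) auto
    moreover have "a 2 * p n' \<ge> -24 * p n'"
      using pos[of n'] Suc a2 by (intro mult_right_mono) auto
    moreover have "7 * p n' \<le> p n" using less.IH[of n'] less.prems Suc by simp
    ultimately show ?thesis unfolding a1 by linarith
  qed
  moreover have "(24 + 8 * real m) * p n - 24 / 7 * p n \<ge> (7 * real (Suc n)) * p n"
  proof -
    have "real n \<le> real m" using less.prems by simp
    hence "24 + 8 * real m - 24 / 7 \<ge> 7 * real (Suc n)"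
      unfolding of_nat_Suc distrib_left by linarith
    from mult_right_mono[OF this, of "p n"] show ?thesis
      using pos[of n] by (simp only: left_diff_distrib less_imp_le)
  qed
  ultimately have "real (Suc n) * (7 * p n) \<le> real (Suc n) * p (Suc n)" by linarith
  hence "7 * p n \<le> p (Suc n)" by (subst (asm) mult_le_cancel_left_pos) auto
  thus ?case using pos[of n] by simp
qed

text \<open>Meant for W = q^(m+1) J / X^m. The number 48 + 32 m is twice the exponent 24 + 16 m,
  since q d/dq doubles on functions of q^2.\<close>

locale eta_quotient_coeffs =
  fixes W :: "complex fps" and m :: nat
  assumes W0: "fps_nth W 0 = 1"
    and log_deriv: "fps_X * fps_deriv W =
      (of_nat (48 + 32 * m) * sigma2_fps - of_nat (24 + 8 * m) * sigma_fps) * W"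
begin

text \<open>The substitution $q \mapsto -q$ makes the coefficients positive.\<close>

definition p :: "nat \<Rightarrow> real" where
  "p n = Re ((-1) ^ n * fps_nth W n)"

lemma p_growth: "n \<le> m \<Longrightarrow> p n > 0 \<and> p (Suc n) \<ge> 7 * p n"
proof (rule eta_quotient_coeff_growth)
  show "p 0 = 1" by (simp add: p_def W0)
  define c where "c = (\<lambda>n. (48 + 32 * real m) * (if even n then divisor_sum (n div 2) else 0)
      - (24 + 8 * real m) * divisor_sum n)"
  have c: "fps_nth (of_nat (48 + 32 * m) * sigma2_fps - of_nat (24 + 8 * m) * sigma_fps) i = of_real (c i)" for i
    unfolding fps_of_nat [symmetric] fps_sub_nth fps_mult_left_const_nth
    by (simp add: c_def sigma2_fps_def sigma_fps_def)
  show "real n * p n = (\<Sum>i\<le>n. ((-1) ^ i * c i) * p (n - i))" for n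
  proof -
    have "fps_nth (fps_X * fps_deriv W) n = of_nat n * fps_nth W n"
      by (cases n) auto
    hence "Re ((-1) ^ n * fps_nth (fps_X * fps_deriv W) n) = Re (of_real (real n) * ((-1) ^ n * fps_nth W n))"
      by (simp add: mult_ac)
    also have "\<dots> = real n * p n"
      by (simp add: p_def del: of_real_of_nat_eq)
    finally show ?thesis
      unfolding log_deriv alternating_fps_mult_nth[OF c] by (simp add: p_def)
  qed
  show "(-1) ^ N * c N = (if odd N then real ((24 + 8 * m) * divisor_sum N)
              else (48 + 32 * real m) * divisor_sum (N div 2) - (24 + 8 * real m) * divisor_sum N)" for N
    by (simp add: c_def)
qed

lemma coeff_nonzero: "fps_nth W (m + 1) \<noteq> 0"
proof
  assume "fps_nth W (m + 1) = 0"
  hence "p (Suc m) = 0" by (simp add: p_def)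
  thus False using p_growth[of m] by auto
qed

lemma p_decay: "N \<le> m \<Longrightarrow> 7 ^ N * p (m - N) \<le> p m"
proof (induction N)
  case (Suc N)
  have "m - N = Suc (m - Suc N)" using Suc.prems by simp
  hence "7 * p (m - Suc N) \<le> p (m - N)" using p_growth[of "m - Suc N"] by simp
  hence "7 ^ N * (7 * p (m - Suc N)) \<le> 7 ^ N * p (m - N)" by (intro mult_left_mono) auto
  also have "\<dots> \<le> p m" using Suc by simp
  finally show ?case by simp
qed simp

text \<open>The difference of the two series is q d/dq log(J X) divided by 16. After q -> -q its
  linear coefficient 1 contributes \<open>p m\<close>, and the later ones together at least -(3/4)
  \<open>p m\<close>, by a geometric series of ratio 3/7.\<close>

lemma sigma_diff_mult_coeff_nonzero: "fps_nth ((sigma2_fps - sigma_fps) * W) (m + 1) \<noteq> 0"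
proof
  assume zero: "fps_nth ((sigma2_fps - sigma_fps) * W) (m + 1) = 0"
  define d where "d = (\<lambda>n. (if even n then real (divisor_sum (n div 2)) else 0) - divisor_sum n)"
  have d: "fps_nth (sigma2_fps - sigma_fps) i = of_real (d i)" for i
    by (simp add: d_def sigma2_fps_def sigma_fps_def)
  have d1: "(-1) ^ 1 * d 1 = 1" by (simp add: d_def divisor_sum_def)
  have dge: "(-1) ^ i * d i \<ge> - real (divisor_sum i)" for i
    by (cases "even i") (auto simp: d_def)
  have pm: "p m > 0" using p_growth[of m] by simp
  have bound: "(-1) ^ (Suc (Suc N)) * d (Suc (Suc N)) * p (m - Suc N) \<ge> - ((3 / 7) ^ Suc N) * p m"
    if "Suc N \<le> m" for N
  proof -
    have pp: "p (m - Suc N) > 0" using p_growth[of "m - Suc N"] by simp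
    have "real (divisor_sum (Suc (Suc N))) \<le> real (3 ^ Suc N)"
      using divisor_sum_le_power_3[of "Suc (Suc N)"] by (subst of_nat_le_iff) simp
    hence "- real (3 ^ Suc N) \<le> (-1) ^ (Suc (Suc N)) * d (Suc (Suc N))"
      using dge[of "Suc (Suc N)"] by linarith
    hence "- real (3 ^ Suc N) * p (m - Suc N) \<le> (-1) ^ (Suc (Suc N)) * d (Suc (Suc N)) * p (m - Suc N)"
      using pp by (intro mult_right_mono) auto
    moreover have "3 ^ Suc N * p (m - Suc N) \<le> (3 / 7) ^ Suc N * p m"
    proof -
      have "(3 / 7) ^ Suc N * (7 ^ Suc N * p (m - Suc N)) \<le> (3 / 7) ^ Suc N * p m"
        by (intro mult_left_mono p_decay[OF that]) auto
      moreover have "(3 / 7) ^ Suc N * 7 ^ Suc N = (3 ^ Suc N :: real)"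
        unfolding power_mult_distrib [symmetric] by simp
      ultimately show ?thesis by (simp only: mult.assoc [symmetric])
    qed
    ultimately show ?thesis unfolding mult_minus_left of_nat_power of_nat_numeral by linarith
  qed
  have "0 = Re ((-1) ^ (m + 1) * fps_nth ((sigma2_fps - sigma_fps) * W) (m + 1))"
    using zero by simp
  also have "\<dots> = (\<Sum>i\<le>Suc m. (-1) ^ i * d i * p (Suc m - i))"
    unfolding alternating_fps_mult_nth[OF d] by (simp add: p_def)
  also have "\<dots> = (-1) ^ 0 * d 0 * p (Suc m) + ((-1) ^ 1 * d 1 * p m +
      (\<Sum>i<m. (-1) ^ Suc (Suc i) * d (Suc (Suc i)) * p (m - Suc i)))"
    by (simp only: lessThan_Suc_atMost [symmetric] sum.lessThan_Suc_shift) simp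
  also have "\<dots> = p m + (\<Sum>i<m. (-1) ^ Suc (Suc i) * d (Suc (Suc i)) * p (m - Suc i))"
    unfolding d1 by (simp add: d_def)
  also have "\<dots> \<ge> p m + (\<Sum>i<m. - ((3 / 7) ^ Suc i) * p m)"
    by (intro add_left_mono sum_mono bound) auto
  also have "(\<Sum>i<m. - ((3 / 7) ^ Suc i) * p m) = - (3 / 7 * (\<Sum>i<m. (3 / 7) ^ i)) * p m"
    by (simp add: sum_distrib_left sum_distrib_right sum_negf mult_ac)
  also have "(\<Sum>i<m. (3 / 7 :: real) ^ i) = 7 / 4 * (1 - (3 / 7) ^ m)"
    by (simp add: sum_gp_strict)
  finally have "0 \<ge> (1 - 3 / 4 * (1 - (3 / 7) ^ m)) * p m" by (simp add: algebra_simps)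
  moreover have "(1 - 3 / 4 * (1 - (3 / 7) ^ m)) * p m > 0"
  proof -
    have "1 - 3 / 4 * (1 - (3 / 7) ^ m) = 1 / 4 + 3 / 4 * (3 / 7 :: real) ^ m"
      by (simp add: algebra_simps)
    also have "\<dots> > 0" by (intro add_pos_pos) auto
    finally show ?thesis using pm by simp
  qed
  ultimately show False by simp
qed

end

section \<open>Modular forms from eta quotients\<close>

text \<open>With P(q) the product of all 1 - q^n this is P(q)^a / P(q^2)^b, that is eta(z)^a /
  eta(2z)^b without its power of q.\<close>

definition euler_quotient :: "nat \<Rightarrow> nat \<Rightarrow> complex \<Rightarrow> complex" where
  "euler_quotient a b q = exp (of_nat b * log_euler (q\<^sup>2) - of_nat a * log_euler q)"

lemma euler_quotient_nonzero [simp]: "euler_quotient a b q \<noteq> 0"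
  by (simp add: euler_quotient_def)

lemma euler_quotient_0 [simp]: "euler_quotient a b 0 = 1"
  by (simp add: euler_quotient_def)

lemma euler_quotient_power: "euler_quotient a b q ^ m = euler_quotient (m * a) (m * b) q"
  by (simp add: euler_quotient_def algebra_simps flip: exp_of_nat_mult)

lemma euler_quotient_mult:
  "euler_quotient a b q * euler_quotient c d q = euler_quotient (a + c) (b + d) q"
  by (simp add: euler_quotient_def algebra_simps flip: exp_add)

lemma norm_power2_less_1: "norm (q :: complex) < 1 \<Longrightarrow> norm (q\<^sup>2) < 1"
  by (rule norm_power_Suc_less_1) auto

lemma euler_quotient_holomorphic: "euler_quotient a b holomorphic_on ball 0 1"
  unfolding euler_quotient_def
  by (intro holomorphic_intros) (auto intro: norm_power2_less_1)

lemma has_field_derivative_euler_quotient: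
  assumes "norm q < 1"
  obtains D where "(euler_quotient a b has_field_derivative D) (at q)"
    and "q * D = (of_nat (2 * b) * eval_fps sigma_fps (q\<^sup>2) - of_nat a * eval_fps sigma_fps q) * euler_quotient a b q"
proof
  let ?L = "eval_fps (fps_deriv log_euler_fps)"
  note q2 = norm_power2_less_1[OF assms]
  have "((\<lambda>q. q\<^sup>2) has_field_derivative 2 * q) (at q)"
    by (auto intro!: derivative_eq_intros)
  from DERIV_chain2[OF has_field_derivative_log_euler[OF q2] this]
  have "((\<lambda>q. log_euler (q\<^sup>2)) has_field_derivative ?L (q\<^sup>2) * (2 * q)) (at q)" .
  thus "(euler_quotient a b has_field_derivative
      (of_nat b * (?L (q\<^sup>2) * (2 * q)) - of_nat a * ?L q) * euler_quotient a b q) (at q)"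
    unfolding euler_quotient_def [abs_def]
    by (auto intro!: derivative_eq_intros has_field_derivative_log_euler[OF assms])
  show "q * ((of_nat b * (?L (q\<^sup>2) * (2 * q)) - of_nat a * ?L q) * euler_quotient a b q) =
      (of_nat (2 * b) * eval_fps sigma_fps (q\<^sup>2) - of_nat a * eval_fps sigma_fps q) * euler_quotient a b q"
    unfolding mult_deriv_log_euler[OF assms, symmetric] mult_deriv_log_euler[OF q2, symmetric]
    by (simp add: algebra_simps power2_eq_square)
qed

lemma has_fps_expansion_sigma: "eval_fps sigma_fps has_fps_expansion sigma_fps"
  by (intro eval_fps_has_fps_expansion less_le_trans[OF _ fps_conv_radius_sigma]) simp

lemma has_fps_expansion_sigma2: "(\<lambda>q. eval_fps sigma_fps (q\<^sup>2)) has_fps_expansion sigma2_fps"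
proof (rule has_fps_expansionI)
  have "eventually (\<lambda>u :: complex. u \<in> ball 0 1) (nhds 0)"
    by (intro eventually_nhds_in_open) auto
  thus "eventually (\<lambda>u. (\<lambda>n. fps_nth sigma2_fps n * u ^ n) sums eval_fps sigma_fps (u\<^sup>2)) (nhds 0)"
  proof eventually_elim
    case (elim u)
    hence "norm (u\<^sup>2) < 1" by (intro norm_power2_less_1) auto
    from sums_eval_fps[OF norm_less_conv_radius_sigma[OF this]]
    have "(\<lambda>n. fps_nth sigma2_fps (2 * n) * u ^ (2 * n)) sums eval_fps sigma_fps (u\<^sup>2)"
      by (simp add: sigma2_fps_def sigma_fps_def power_mult)
    moreover have "strict_mono (\<lambda>n :: nat. 2 * n)" by (auto simp: strict_mono_def)
    moreover have "fps_nth sigma2_fps n * u ^ n = 0" if "n \<notin> range ((*) 2)" for n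
      using that by (auto simp: sigma2_fps_def elim!: evenE)
    ultimately show ?case
      using sums_mono_reindex[of "\<lambda>n. 2 * n" "\<lambda>n. fps_nth sigma2_fps n * u ^ n"] by simp
  qed
qed

definition euler_quotient_fps :: "nat \<Rightarrow> nat \<Rightarrow> complex fps" where
  "euler_quotient_fps a b = fps_expansion (euler_quotient a b) 0"

lemma has_fps_expansion_euler_quotient:
  "euler_quotient a b has_fps_expansion euler_quotient_fps a b"
  unfolding euler_quotient_fps_def
  by (rule has_fps_expansion_fps_expansion[of "ball 0 1"]) (auto intro: euler_quotient_holomorphic)

lemma euler_quotient_fps_nth_0 [simp]: "fps_nth (euler_quotient_fps a b) 0 = 1"
  using fps_nth_fps_expansion[OF has_fps_expansion_euler_quotient, of a b 0] by simp

lemma mult_deriv_euler_quotient: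
  assumes "norm q < 1"
  shows "q * deriv (euler_quotient a b) q =
    (of_nat (2 * b) * eval_fps sigma_fps (q\<^sup>2) - of_nat a * eval_fps sigma_fps q) * euler_quotient a b q"
  using has_field_derivative_euler_quotient[OF assms, of a b] DERIV_imp_deriv by metis

lemma euler_quotient_fps_log_deriv:
  "fps_X * fps_deriv (euler_quotient_fps a b) =
     (of_nat (2 * b) * sigma2_fps - of_nat a * sigma_fps) * euler_quotient_fps a b"
proof (rule fps_expansion_unique_complex)
  show "(\<lambda>q. q * deriv (euler_quotient a b) q) has_fps_expansion
      fps_X * fps_deriv (euler_quotient_fps a b)"
    by (intro fps_expansion_intros has_fps_expansion_euler_quotient)
  have "(\<lambda>q. (of_nat (2 * b) * eval_fps sigma_fps (q\<^sup>2) - of_nat a * eval_fps sigma_fps q)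
           * euler_quotient a b q) has_fps_expansion
     (fps_const (of_nat (2 * b)) * sigma2_fps - fps_const (of_nat a) * sigma_fps) * euler_quotient_fps a b"
    by (intro fps_expansion_intros has_fps_expansion_euler_quotient
        has_fps_expansion_sigma has_fps_expansion_sigma2)
  moreover have "eventually (\<lambda>q :: complex. q \<in> ball 0 1) (nhds 0)"
    by (intro eventually_nhds_in_open) auto
  hence "eventually (\<lambda>q. (of_nat (2 * b) * eval_fps sigma_fps (q\<^sup>2) - of_nat a * eval_fps sigma_fps q)
           * euler_quotient a b q = q * deriv (euler_quotient a b) q) (nhds 0)"
    by eventually_elim (simp only: mult_deriv_euler_quotient mem_ball dist_0_norm)
  ultimately show "(\<lambda>q. q * deriv (euler_quotient a b) q) has_fps_expansion
     (of_nat (2 * b) * sigma2_fps - of_nat a * sigma_fps) * euler_quotient_fps a b"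
    unfolding fps_of_nat [symmetric] by (subst (asm) has_fps_expansion_cong) (rule refl | assumption)+
qed

section \<open>The eta quotients X and J at the cusps infinity and 0\<close>

lemma nome_plus_1 [simp]: "nome (z + 1) = nome z"
  by (simp add: nome_def exp_add distrib_left)

lemma nome_double: "nome (2 * z) = (nome z)\<^sup>2"
  by (simp add: nome_def flip: exp_double)

lemma nome_nonzero [simp]: "nome z \<noteq> 0"
  by (simp add: nome_def)

text \<open>In classical notation \<open>X_form\<close> is $\eta(2z)^{16} / \eta(z)^8$, a form of weight 4 whose only
  zero is a simple one at infinity, and \<open>hauptmodul\<close> is $(\eta(z) / \eta(2z))^{24}$, which vanishes at
  the cusp 0.\<close>

definition X_form :: "complex \<Rightarrow> complex" where
  "X_form z = nome z / euler_quotient 8 16 (nome z)"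

definition hauptmodul :: "complex \<Rightarrow> complex" where
  "hauptmodul z = euler_quotient 24 24 (nome z) / nome z"

lemma X_form_nonzero [simp]: "X_form z \<noteq> 0"
  by (simp add: X_form_def)

lemma X_form_eta8: "X_form z = (eta8 (2 * z))\<^sup>2 / eta8 z"
proof -
  have "(eta8 (2 * z))\<^sup>2 = exp (2 * (2 * of_real pi * \<i> * (2 * z) / 3 - 8 * log_euler ((nome z)\<^sup>2)))"
    by (simp only: eta8_def nome_double exp_double)
  also have "\<dots> / eta8 z = exp (2 * of_real pi * \<i> * z - (16 * log_euler ((nome z)\<^sup>2) - 8 * log_euler (nome z)))"
    unfolding eta8_def exp_diff [symmetric] by (rule arg_cong[of _ _ exp]) (simp add: field_simps)
  finally show ?thesis
    by (simp add: X_form_def nome_def euler_quotient_def exp_diff)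
qed

lemma hauptmodul_eta8: "hauptmodul z = (eta8 z / eta8 (2 * z)) ^ 3"
proof -
  have "eta8 z / eta8 (2 * z) = exp ((2 * of_real pi * \<i> * z / 3 - 8 * log_euler (nome z)) -
      (2 * of_real pi * \<i> * (2 * z) / 3 - 8 * log_euler ((nome z)\<^sup>2)))"
    unfolding eta8_def nome_double by (rule exp_diff [symmetric])
  hence "(eta8 z / eta8 (2 * z)) ^ 3 = exp (of_nat 3 * ((2 * of_real pi * \<i> * z / 3 - 8 * log_euler (nome z)) -
      (2 * of_real pi * \<i> * (2 * z) / 3 - 8 * log_euler ((nome z)\<^sup>2))))"
    by (simp only: exp_of_nat_mult)
  also have "\<dots> = exp ((24 * log_euler ((nome z)\<^sup>2) - 24 * log_euler (nome z)) - 2 * of_real pi * \<i> * z)"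
    by (rule arg_cong[of _ _ exp]) (simp add: field_simps)
  finally show ?thesis
    by (simp add: hauptmodul_def nome_def euler_quotient_def exp_diff)
qed

text \<open>Inversion turns doubling into halving, as 2 (-1/w) = -1/(w/2). So nome(w/2) is the
  parameter at the cusp 0, and 1/256 is the square of the factor 2^(-4). The remaining quotient is 1
  at 0, hence X does not vanish at this cusp.\<close>

lemma X_form_inversion:
  assumes "Im w > 0"
  shows "X_form (- 1 / w) = w ^ 4 / 256 * euler_quotient 16 8 (nome (w / 2))"
proof -
  have "Im (w / 2) > 0" using assms by simp
  from eta8_inversion[OF this] have "eta8 (2 * (- 1 / w)) = (w / 2) ^ 4 * eta8 (w / 2)"
    by simp
  hence "X_form (- 1 / w) = ((w / 2) ^ 4 * eta8 (w / 2))\<^sup>2 / (w ^ 4 * eta8 w)"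
    by (simp only: X_form_eta8 eta8_inversion[OF assms])
  also have "\<dots> = w ^ 4 / 256 * ((eta8 (w / 2))\<^sup>2 / eta8 w)"
    by (cases "w = 0") (simp_all add: field_simps power2_eq_square power4_eq_xxxx)
  also have "(eta8 (w / 2))\<^sup>2 / eta8 w = euler_quotient 16 8 (nome (w / 2))"
  proof -
    have n: "nome w = (nome (w / 2))\<^sup>2" using nome_double[of "w / 2"] by simp
    have "(eta8 (w / 2))\<^sup>2 = exp (2 * (2 * of_real pi * \<i> * (w / 2) / 3 - 8 * log_euler (nome (w / 2))))"
      by (simp only: eta8_def exp_double)
    also have "\<dots> / eta8 w = exp (8 * log_euler ((nome (w / 2))\<^sup>2) - 16 * log_euler (nome (w / 2)))"
      unfolding eta8_def n exp_diff [symmetric] by (rule arg_cong[of _ _ exp]) (simp add: field_simps)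
    finally show ?thesis by (simp add: euler_quotient_def)
  qed
  finally show ?thesis .
qed

text \<open>Shows the simple zero at the cusp 0. The constant 4096 is the cube of the 2^4 that comes
  from (w/2)^4 in the denominator.\<close>

lemma hauptmodul_inversion:
  assumes "Im w > 0"
  shows "hauptmodul (- 1 / w) = 4096 * (nome (w / 2) / euler_quotient 24 24 (nome (w / 2)))"
proof -
  have "Im (w / 2) > 0" using assms by simp
  from eta8_inversion[OF this] have "eta8 (2 * (- 1 / w)) = (w / 2) ^ 4 * eta8 (w / 2)"
    by simp
  hence "hauptmodul (- 1 / w) = ((w ^ 4 * eta8 w) / ((w / 2) ^ 4 * eta8 (w / 2))) ^ 3"
    by (simp only: hauptmodul_eta8 eta8_inversion[OF assms])
  also have "\<dots> = 4096 / (eta8 (w / 2) / eta8 w) ^ 3"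
    using assms by (auto simp: field_simps power3_eq_cube power4_eq_xxxx)
  also have "(eta8 (w / 2) / eta8 w) ^ 3 = hauptmodul (w / 2)"
    using hauptmodul_eta8[of "w / 2"] by simp
  finally show ?thesis by (simp add: hauptmodul_def)
qed

lemma nome_half_plus_2: "nome ((w + 2) / 2) = nome (w / 2)"
  using nome_plus_1[of "w / 2"] by (simp add: add_divide_distrib)

text \<open>In the coordinate w = -1/z the map z/(1 - 2 z) is the translation w + 2. Since nome(w/2)
  has period 2, the inversion formulas yield the behaviour of X and J under this map.\<close>

lemma parabolic_conj:
  assumes "Im z > 0"
  shows "Im (- 1 / z) > 0" "Im (- 1 / z + 2) > 0" "1 - 2 * z \<noteq> 0"
    "z / (1 - 2 * z) = - 1 / (- 1 / z + 2)" "z = - 1 / (- 1 / z)" "- 1 / z + 2 = (1 - 2 * z) * (- 1 / z)"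
    "Im (z / (1 - 2 * z)) > 0"
proof -
  show 1: "Im (- 1 / z) > 0" using assms by (rule Im_inversion_pos)
  show 2: "Im (- 1 / z + 2) > 0" using 1 by simp
  have z: "z \<noteq> 0" using assms by auto
  show 3: "1 - 2 * z \<noteq> 0" using assms by (auto simp: complex_eq_iff)
  show 4: "- 1 / z + 2 = (1 - 2 * z) * (- 1 / z)" using z by (simp add: field_simps)
  show 5: "z / (1 - 2 * z) = - 1 / (- 1 / z + 2)" unfolding 4 using z 3 by (simp add: field_simps)
  show "z = - 1 / (- 1 / z)" using z by simp
  show "Im (z / (1 - 2 * z)) > 0" unfolding 5 by (rule Im_inversion_pos[OF 2])
qed

lemma X_form_parabolic:
  assumes "Im z > 0"
  shows "X_form (z / (1 - 2 * z)) = (1 - 2 * z) ^ 4 * X_form z"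
proof -
  define w where "w = - 1 / z"
  note w = parabolic_conj[OF assms, folded w_def]
  have z: "z \<noteq> 0" using assms by auto
  have "X_form (z / (1 - 2 * z)) = (w + 2) ^ 4 / 256 * euler_quotient 16 8 (nome (w / 2))"
    unfolding w(4) X_form_inversion[OF w(2)] nome_half_plus_2 ..
  also have "(w + 2) ^ 4 = (1 - 2 * z) ^ 4 * w ^ 4"
    unfolding w(6) by (rule power_mult_distrib)
  finally have "X_form (z / (1 - 2 * z)) = (1 - 2 * z) ^ 4 * X_form (- 1 / w)"
    unfolding X_form_inversion[OF w(1)]
    by (simp only: mult.assoc times_divide_eq_left times_divide_eq_right)
  thus ?thesis using w(5) by simp
qed

lemma hauptmodul_parabolic:
  assumes "Im z > 0"
  shows "hauptmodul (z / (1 - 2 * z)) = hauptmodul z"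
proof -
  define w where "w = - 1 / z"
  note w = parabolic_conj[OF assms, folded w_def]
  have "hauptmodul (z / (1 - 2 * z)) = hauptmodul (- 1 / w)"
    unfolding w(4) hauptmodul_inversion[OF w(2)] hauptmodul_inversion[OF w(1)] nome_half_plus_2 ..
  thus ?thesis using w(5) by simp
qed

section \<open>Forms of weight 2\<close>

lemma upper_half_plane_iff [simp]: "z \<in> upper_half_plane \<longleftrightarrow> Im z > 0"
  by (simp add: upper_half_plane_def)

lemma open_upper_half_plane: "open upper_half_plane"
  unfolding upper_half_plane_def by (rule open_halfspace_Im_gt)

lemma convex_upper_half_plane: "convex upper_half_plane"
  unfolding upper_half_plane_def by (rule convex_halfspace_Im_gt)

text \<open>A primitive $\Phi$ of a weight 2 form changes by constants $c_1$, $c_2$ under $z \mapsto z + 1$ and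
  $z \mapsto z/(1-2z)$. The composition of the two maps fixes $(1 + i)/2$, so $c_1 + c_2 = 0$, and
  $c_2 = 0$ because the form vanishes at the cusp 0.\<close>

lemma weight_2_primitive_periodic:
  assumes holo: "F holomorphic_on upper_half_plane"
    and T: "\<And>z. Im z > 0 \<Longrightarrow> F (z + 1) = F z"
    and V: "\<And>z. Im z > 0 \<Longrightarrow> F (z / (1 - 2 * z)) = (1 - 2 * z)\<^sup>2 * F z"
    and cusp: "\<And>e. e > 0 \<Longrightarrow> \<exists>y. \<forall>w. Im w > y \<longrightarrow> norm (F (- 1 / w) / w\<^sup>2) \<le> e"
  obtains \<Phi> where "\<And>z. Im z > 0 \<Longrightarrow> (\<Phi> has_field_derivative F z) (at z)"
    and "\<And>z. Im z > 0 \<Longrightarrow> \<Phi> (z + 1) = \<Phi> z"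
proof -
  obtain \<Phi> where \<Phi>': "\<And>z. z \<in> upper_half_plane \<Longrightarrow>
      (\<Phi> has_field_derivative F z) (at z within upper_half_plane)"
    using holomorphic_convex_primitive'[OF convex_upper_half_plane open_upper_half_plane holo] by blast
  hence \<Phi>: "(\<Phi> has_field_derivative F z) (at z)" if "Im z > 0" for z
  proof -
    have "z \<in> upper_half_plane" using that by simp
    from \<Phi>'[OF this] at_within_open[OF this open_upper_half_plane] show ?thesis by simp
  qed
  have const: "\<exists>c. \<forall>z. Im z > 0 \<longrightarrow> G z = c"
    if "\<And>z. Im z > 0 \<Longrightarrow> (G has_field_derivative 0) (at z)" for G :: "complex \<Rightarrow> complex"
  proof -
    have "\<exists>c. \<forall>z\<in>upper_half_plane. G z = c"
      by (rule has_field_derivative_zero_constant[OF convex_upper_half_plane])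
         (use that in \<open>auto intro: has_field_derivative_at_within\<close>)
    thus ?thesis unfolding Ball_def upper_half_plane_def mem_Collect_eq .
  qed
  have "((\<lambda>z. \<Phi> (z + 1) - \<Phi> z) has_field_derivative 0) (at z)" if "Im z > 0" for z
  proof -
    have "((\<lambda>z. \<Phi> (z + 1)) has_field_derivative F (z + 1)) (at z)"
      using \<Phi>[of "z + 1"] that by (simp add: DERIV_shift)
    from DERIV_diff[OF this \<Phi>[OF that]] show ?thesis using T[OF that] by simp
  qed
  from const[OF this] obtain c1 where "\<And>z. Im z > 0 \<Longrightarrow> \<Phi> (z + 1) - \<Phi> z = c1" by blast
  hence c1: "\<Phi> (z + 1) = c1 + \<Phi> z" if "Im z > 0" for z
    using that by (simp add: diff_eq_eq)
  have "((\<lambda>z. \<Phi> (z / (1 - 2 * z)) - \<Phi> z) has_field_derivative 0) (at z)" if "Im z > 0" for z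
  proof -
    note z = parabolic_conj(3,7)[OF that]
    have "((\<lambda>z. z / (1 - 2 * z)) has_field_derivative 1 / (1 - 2 * z)\<^sup>2) (at z)"
      using z by (auto intro!: derivative_eq_intros simp: power2_eq_square algebra_simps)
    from DERIV_chain2[OF \<Phi>[OF z(2)] this]
    have "((\<lambda>z. \<Phi> (z / (1 - 2 * z))) has_field_derivative F z) (at z)"
      using z by (simp add: V[OF that])
    from DERIV_diff[OF this \<Phi>[OF that]] show ?thesis by simp
  qed
  from const[OF this] obtain c2 where "\<And>z. Im z > 0 \<Longrightarrow> \<Phi> (z / (1 - 2 * z)) - \<Phi> z = c2" by blast
  hence c2: "\<Phi> (z / (1 - 2 * z)) = c2 + \<Phi> z" if "Im z > 0" for z
    using that by (simp add: diff_eq_eq)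
  have "c1 + c2 = 0"
  proof -
    define z where "z = (1 + \<i>) / 2"
    have z: "Im z > 0" by (simp add: z_def)
    have fix1: "z / (1 - 2 * z) + 1 = z"
    proof -
      have "1 - 2 * z = - \<i>" by (simp add: z_def complex_eq_iff)
      moreover have "z / (- \<i>) + 1 = z"
        by (simp add: z_def complex_eq_iff Re_divide Im_divide)
      ultimately show ?thesis by simp
    qed
    have "\<Phi> z = c1 + \<Phi> (z / (1 - 2 * z))"
      using c1[OF parabolic_conj(7)[OF z]] by (simp only: fix1)
    thus ?thesis by (simp add: c2[OF z])
  qed
  moreover have "c2 = 0"
  proof (rule ccontr)
    assume "c2 \<noteq> 0"
    \<comment> \<open>The points w and w + 2 are at distance 2, so this choice leads to |c2| <=
      |c2|/2.\<close>
    define e where "e = norm c2 / 4"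
    have "e > 0" using \<open>c2 \<noteq> 0\<close> by (simp add: e_def)
    from cusp[OF this] obtain y where y: "\<And>w. Im w > y \<Longrightarrow> norm (F (- 1 / w) / w\<^sup>2) \<le> e" by blast
    define y' where "y' = max y 0"
    define w where "w = \<i> * of_real (y' + 1)"
    have w: "Im w > y'" by (simp add: w_def)
    have wpos: "Im u > 0" "u \<noteq> 0" if "Im u > y'" for u
      using that by (auto simp: y'_def)
    have "norm (\<Phi> (- 1 / (w + 2)) - \<Phi> (- 1 / w)) \<le> e * norm ((w + 2) - w)"
    proof (rule field_differentiable_bound[of "{u. Im u > y'}"])
      show "convex {u. Im u > y'}" by (rule convex_halfspace_Im_gt)
      show "((\<lambda>u. \<Phi> (- 1 / u)) has_field_derivative F (- 1 / u) / u\<^sup>2) (at u within {u. Im u > y'})"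
        if "u \<in> {u. Im u > y'}" for u
      proof -
        have u: "Im u > 0" "u \<noteq> 0" using wpos that by auto
        have "((\<lambda>u. - 1 / u) has_field_derivative 1 / u\<^sup>2) (at u)"
          using u by (auto intro!: derivative_eq_intros simp: power2_eq_square)
        from DERIV_chain2[OF \<Phi>[OF Im_inversion_pos[OF u(1)]] this] show ?thesis
          by (simp add: has_field_derivative_at_within)
      qed
      show "norm (F (- 1 / u) / u\<^sup>2) \<le> e" if "u \<in> {u. Im u > y'}" for u
        using y[of u] that by (auto simp: y'_def)
    qed (use w in auto)
    moreover have "\<Phi> (- 1 / (w + 2)) - \<Phi> (- 1 / w) = c2"
    proof -
      define z where "z = - 1 / w"
      have z: "Im z > 0" unfolding z_def by (rule Im_inversion_pos[OF wpos(1)[OF w]])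
      have "- 1 / z = w" using wpos(2)[OF w] by (simp add: z_def)
      hence "z / (1 - 2 * z) = - 1 / (w + 2)"
        using parabolic_conj(4)[OF z] by simp
      thus ?thesis using c2[OF z] by (simp add: z_def)
    qed
    ultimately have "norm c2 \<le> e * 2" by simp
    thus False using \<open>e > 0\<close> by (simp add: e_def)
  qed
  ultimately have "c1 = 0" by simp
  thus ?thesis using \<Phi> c1 by (intro that[of \<Phi>]) auto
qed

text \<open>By periodicity the derivative integrates to 0 over a horizontal segment of length 1. In
  the variable q the segment is a circle about 0, and dz = dq/(2 pi i q) raises the exponent to k +
  1, so Cauchy's formula yields the coefficient of q^k.\<close>

lemma periodic_primitive_imp_coeff_zero:
  assumes H: "H holomorphic_on ball 0 1"
    and \<Phi>: "\<And>z. Im z > 0 \<Longrightarrow> (\<Phi> has_field_derivative H (nome z) / nome z ^ k) (at z)"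
    and per: "\<And>z. Im z > 0 \<Longrightarrow> \<Phi> (z + 1) = \<Phi> z"
  shows "(deriv ^^ k) H 0 = 0"
proof -
  \<comment> \<open>The height at which q has modulus 1/2.\<close>
  define y where "y = ln 2 / (2 * pi)"
  have y: "y > 0" by (simp add: y_def)
  define z where "z = (\<lambda>t::real. \<i> * of_real y + of_real t)"
  have nome_z: "nome (z t) = circlepath 0 (1 / 2) t" for t
  proof -
    have "2 * of_real pi * \<i> * z t = of_real (- ln 2) + 2 * of_real pi * \<i> * of_real t"
      by (simp add: z_def y_def algebra_simps)
    hence "nome (z t) = exp (of_real (- ln 2)) * exp (2 * of_real pi * \<i> * of_real t)"
      by (simp only: nome_def exp_add)
    also have "exp (of_real (- ln 2)) = (1 / 2 :: complex)"
      unfolding exp_of_real by (simp add: exp_minus)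
    finally show ?thesis by (simp add: circlepath)
  qed
  have "((\<lambda>t. H (nome (z t)) / nome (z t) ^ k) has_integral (\<Phi> (z 1) - \<Phi> (z 0))) {0..1}"
  proof (rule fundamental_theorem_of_calculus)
    fix t :: real
    have "Im (z t) > 0" using y by (simp add: z_def)
    have "(z has_vector_derivative 1) (at t within {0..1})"
      unfolding z_def by (auto intro!: derivative_eq_intros)
    from field_vector_diff_chain_within[OF this has_field_derivative_at_within[OF \<Phi>[OF \<open>Im (z t) > 0\<close>]]]
    show "((\<lambda>t. \<Phi> (z t)) has_vector_derivative H (nome (z t)) / nome (z t) ^ k) (at t within {0..1})"
      by (simp add: o_def)
  qed auto
  moreover have "z 1 = z 0 + 1" by (simp add: z_def)
  hence "\<Phi> (z 1) = \<Phi> (z 0)" using per[of "z 0"] y by (simp add: z_def)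
  ultimately have "((\<lambda>t. H (nome (z t)) / nome (z t) ^ k) has_integral 0) {0..1}" by simp
  hence "((\<lambda>t. (2 * of_real pi * \<i>) * (H (nome (z t)) / nome (z t) ^ k)) has_integral 0) {0..1}"
    using has_integral_mult_right[of _ 0 "{0..1}" "2 * of_real pi * \<i>"] by fastforce
  hence "((\<lambda>u. H u / (u - 0) ^ Suc k) has_contour_integral 0) (circlepath 0 (1 / 2))"
    unfolding has_contour_integral_def
  proof (rule has_integral_eq[rotated])
    fix t :: real assume t: "t \<in> {0..1}"
    have "vector_derivative (circlepath 0 (1 / 2)) (at t within {0..1}) = 2 * of_real pi * \<i> * nome (z t)"
      using t unfolding nome_z by (subst vector_derivative_circlepath01) (auto simp: circlepath)
    thus "(2 * of_real pi * \<i>) * (H (nome (z t)) / nome (z t) ^ k) =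
       H (circlepath 0 (1 / 2) t) / (circlepath 0 (1 / 2) t - 0) ^ Suc k *
       vector_derivative (circlepath 0 (1 / 2)) (at t within {0..1})"
      unfolding nome_z [symmetric] by (simp add: field_simps)
  qed
  moreover have "((\<lambda>u. H u / (u - 0) ^ Suc k) has_contour_integral
      ((2 * pi * \<i>) / (fact k) * (deriv ^^ k) H 0)) (circlepath 0 (1 / 2))"
    by (rule Cauchy_has_contour_integral_higher_derivative_circlepath)
       (auto intro!: holomorphic_on_imp_continuous_on holomorphic_on_subset[OF H])
  ultimately have "(2 * pi * \<i>) / (fact k) * (deriv ^^ k) H 0 = 0"
    using contour_integral_unique by metis
  thus ?thesis by simp
qed

section \<open>The constant term of the weight 2 form\<close>

lemma nome_tendsto_zero:
  assumes "d > 0"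
  obtains y where "y > 0" "\<And>w. Im w > y \<Longrightarrow> norm (nome (w / 2)) < d"
proof
  define y where "y = max 1 (- ln d / pi)"
  show "y > 0" by (simp add: y_def)
  fix w :: complex assume "Im w > y"
  hence "Im w > - ln d / pi" by (simp add: y_def)
  hence "- (pi * Im w) < ln d" by (simp add: field_simps)
  hence "exp (- (pi * Im w)) < exp (ln d)" by (subst exp_less_cancel_iff)
  thus "norm (nome (w / 2)) < d" using assms by (simp add: nome_def norm_exp_eq_Re)
qed

lemma modular_form_parabolic:
  assumes "modular_form_Gamma0_2 h f" "Im z > 0"
  shows "f (z / (1 - 2 * z)) = (1 - 2 * z) ^ h * f z"
proof -
  have "f (moebius_int 1 0 (- 2) 1 z) = (of_int (- 2) * z + of_int 1) ^ h * f z"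
    using assms unfolding modular_form_Gamma0_2_def by (auto simp del: of_int_0 of_int_1)
  thus ?thesis by (simp add: moebius_int_def)
qed

lemma modular_form_cusp_0:
  assumes "modular_form_Gamma0_2 h f"
  obtains M y where "\<And>w. Im w > y \<Longrightarrow> norm (f (- 1 / w) / w ^ h) \<le> M"
proof -
  have "\<forall>a b c d :: int. a * d - b * c = 1 \<longrightarrow>
        (\<exists>M y0. \<forall>z. Im z > y0 \<longrightarrow>
           norm (f (moebius_int a b c d z) / (of_int c * z + of_int d) ^ h) \<le> M)"
    by (rule conjunct2[OF conjunct2[OF assms[unfolded modular_form_Gamma0_2_def]]])
  from this[THEN spec, of 0, THEN spec, of "- 1", THEN spec, of 1, THEN spec, of 0]
  have "\<exists>M y0. \<forall>z. Im z > y0 \<longrightarrow>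
           norm (f (moebius_int 0 (- 1) 1 0 z) / (of_int 1 * z + of_int 0) ^ h) \<le> M"
    by simp
  then obtain M y where M: "\<And>w. Im w > y \<Longrightarrow>
      norm (f (moebius_int 0 (- 1) 1 0 w) / (of_int 1 * w + of_int 0) ^ h) \<le> M"
    by blast
  show ?thesis
  proof (rule that)
    show "norm (f (- 1 / w) / w ^ h) \<le> M" if "Im w > y" for w
      using M[OF that] by (simp add: moebius_int_def)
  qed
qed

text \<open>Used with $g$ equal to \<open>hauptmodul\<close> ($j = 0$) or a multiple of its derivative ($j = 2$). The
  coefficient is the constant term of the weight 2 form $f g / X^m$.\<close>

lemma constant_term_zero:
  fixes A :: "nat \<Rightarrow> complex"
  assumes mf: "modular_form_Gamma0_2 h f"
    and expansion: "\<And>z. Im z > 0 \<Longrightarrow> (\<lambda>n. A n * nome z ^ n) sums f z"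
    and wt: "h + j = 4 * m + 2"
    and B_holo: "B holomorphic_on ball 0 1"
    and g: "\<And>z. g z = B (nome z) / nome z"
    and g_V: "\<And>z. Im z > 0 \<Longrightarrow> g (z / (1 - 2 * z)) = (1 - 2 * z) ^ j * g z"
    and g_S: "\<And>w. Im w > 0 \<Longrightarrow> g (- 1 / w) = w ^ j * C (nome (w / 2))"
    and C: "isCont C 0" "C 0 = 0"
  shows "fps_nth (Abs_fps A * (fps_expansion B 0 * euler_quotient_fps (m * 8) (m * 16))) (m + 1) = 0"
proof -
  define E where "E = euler_quotient (m * 8) (m * 16)"
  define F where "F = (\<lambda>z. f z * g z / X_form z ^ m)"
  have radius: "fps_conv_radius (Abs_fps A) \<ge> 1"
    unfolding fps_conv_radius_def
  proof (rule conv_radius_geI_ex')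
    fix r :: real assume r: "0 < r" "ereal r < 1"
    \<comment> \<open>Every r in (0, 1) is the nome of a point on the positive imaginary axis, where
      the expansion is known to converge.\<close>
    define z where "z = \<i> * of_real (- ln r / (2 * pi))"
    have "Im z > 0" using r by (simp add: z_def field_simps)
    moreover have "nome z = of_real r"
    proof -
      have "2 * of_real pi * \<i> * z = of_real (ln r)"
        by (simp add: z_def)
      thus ?thesis using r by (simp add: nome_def exp_of_real)
    qed
    ultimately show "summable (\<lambda>n. fps_nth (Abs_fps A) n * of_real r ^ n)"
      using expansion[of z] by (simp add: sums_iff)
  qed
  have less: "ereal (norm q) < fps_conv_radius (Abs_fps A)" if "norm q < 1" for q :: complex
    using that by (intro less_le_trans[OF _ radius]) simp
  have f_eval: "f z = eval_fps (Abs_fps A) (nome z)" if "Im z > 0" for z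
    using sums_eval_fps[OF less[OF norm_nome_less_1[OF that]]] expansion[OF that]
    by (simp add: sums_iff)
  define H where "H = (\<lambda>q. eval_fps (Abs_fps A) q * (B q * E q))"
  have H_holo: "H holomorphic_on ball 0 1"
    unfolding H_def E_def
    by (intro holomorphic_on_mult holomorphic_on_eval_fps euler_quotient_holomorphic B_holo)
       (auto intro: less)
  \<comment> \<open>The pole has order m from X^m and 1 from \<open>g\<close>, so the constant term
    of \<open>F\<close> is the coefficient m + 1 of \<open>H\<close>.\<close>
  have F_H: "F z = H (nome z) / nome z ^ (m + 1)" if "Im z > 0" for z
    by (simp add: F_def H_def E_def f_eval[OF that] g X_form_def power_divide euler_quotient_power)
  have nome_holo: "nome holomorphic_on upper_half_plane"
    unfolding nome_def by (intro holomorphic_intros)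
  have F_holo: "F holomorphic_on upper_half_plane"
  proof -
    have "(\<lambda>z. H (nome z)) holomorphic_on upper_half_plane"
    proof -
      have "nome ` upper_half_plane \<subseteq> ball 0 1" using norm_nome_less_1 by auto
      from holomorphic_on_compose_gen[OF nome_holo H_holo this] show ?thesis by (simp add: o_def)
    qed
    hence "(\<lambda>z. H (nome z) / nome z ^ (m + 1)) holomorphic_on upper_half_plane"
      using nome_holo by (intro holomorphic_intros) auto
    thus ?thesis by (rule holomorphic_transform) (use F_H in auto)
  qed
  have F_T: "F (z + 1) = F z" if "Im z > 0" for z
    using F_H[of "z + 1"] F_H[OF that] that by simp
  have F_V: "F (z / (1 - 2 * z)) = (1 - 2 * z)\<^sup>2 * F z" if "Im z > 0" for z
  proof -
    note nz = parabolic_conj(3)[OF that]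
    have "F (z / (1 - 2 * z)) = ((1 - 2 * z) ^ h * (1 - 2 * z) ^ j / ((1 - 2 * z) ^ 4) ^ m) * F z"
      unfolding F_def modular_form_parabolic[OF mf that] g_V[OF that] X_form_parabolic[OF that]
      by (simp add: power_mult_distrib)
    also have "(1 - 2 * z) ^ h * (1 - 2 * z) ^ j = ((1 - 2 * z) ^ 4) ^ m * (1 - 2 * z)\<^sup>2"
      unfolding power_mult [symmetric] power_add [symmetric] wt ..
    finally show ?thesis using nz by simp
  qed
  \<comment> \<open>What \<open>g\<close> and X^m leave at the cusp 0 once the powers of w have
    combined with the weight of \<open>f\<close>. There f(-1/w)/w^h is bounded and \<open>R\<close>
    tends to 0 along with \<open>C\<close>.\<close>
  define R where "R = (\<lambda>p. 256 ^ m * (C p / euler_quotient (m * 16) (m * 8) p))"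
  have F_S: "F (- 1 / w) / w\<^sup>2 = f (- 1 / w) / w ^ h * R (nome (w / 2))" if "Im w > 0" for w
  proof -
    have w0: "w \<noteq> 0" using that by auto
    have "w ^ h * w ^ j = (w ^ 4) ^ m * w\<^sup>2"
      unfolding power_mult [symmetric] power_add [symmetric] wt ..
    hence "w ^ j / ((w ^ 4) ^ m * w\<^sup>2) = 1 / w ^ h"
      using w0 by (simp add: divide_simps) (simp add: mult_ac)
    moreover have "F (- 1 / w) / w\<^sup>2 = f (- 1 / w) * (w ^ j / ((w ^ 4) ^ m * w\<^sup>2)) * R (nome (w / 2))"
      unfolding F_def g_S[OF that] X_form_inversion[OF that] R_def
      by (simp add: power_mult_distrib power_divide euler_quotient_power mult_ac)
    ultimately show ?thesis by simp
  qed
  have R: "isCont R 0" "R 0 = 0"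
  proof -
    have "isCont (euler_quotient (m * 16) (m * 8)) 0"
      using holomorphic_on_imp_continuous_on[OF euler_quotient_holomorphic]
      by (simp add: continuous_on_eq_continuous_at)
    thus "isCont R 0" unfolding R_def by (intro continuous_intros C) auto
  qed (simp add: R_def C)
  have cusp: "\<exists>y. \<forall>w. Im w > y \<longrightarrow> norm (F (- 1 / w) / w\<^sup>2) \<le> e" if e: "e > 0" for e
  proof -
    obtain M y1 where M: "\<And>w. Im w > y1 \<Longrightarrow> norm (f (- 1 / w) / w ^ h) \<le> M"
      using modular_form_cusp_0[OF mf] by blast
    define M' where "M' = max M 1"
    have M': "M' > 0" "M \<le> M'" by (auto simp: M'_def)
    have "R \<midarrow>0\<rightarrow> 0" using R by (simp add: isCont_def)
    from LIM_D[OF this, of "e / M'"] obtain d where d: "d > 0"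
      "\<And>x. x \<noteq> 0 \<Longrightarrow> norm x < d \<Longrightarrow> norm (R x) < e / M'"
      using e M' by auto
    obtain y2 where y2: "y2 > 0" "\<And>w. Im w > y2 \<Longrightarrow> norm (nome (w / 2)) < d"
      using nome_tendsto_zero[OF d(1)] by blast
    have "norm (F (- 1 / w) / w\<^sup>2) \<le> e" if w: "Im w > max y1 y2" for w
    proof -
      have "norm (F (- 1 / w) / w\<^sup>2) = norm (f (- 1 / w) / w ^ h) * norm (R (nome (w / 2)))"
        using F_S[of w] w y2(1) by (simp only: norm_mult)
      also have "\<dots> \<le> M' * (e / M')"
        using M[of w] M' w y2(2)[of w] d(2)[of "nome (w / 2)"] by (intro mult_mono) auto
      also have "\<dots> = e" using M' by simp
      finally show ?thesis .
    qed
    thus ?thesis by blast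
  qed
  obtain \<Phi> where \<Phi>: "\<And>z. Im z > 0 \<Longrightarrow> (\<Phi> has_field_derivative F z) (at z)"
    "\<And>z. Im z > 0 \<Longrightarrow> \<Phi> (z + 1) = \<Phi> z"
    using weight_2_primitive_periodic[OF F_holo F_T F_V cusp] by blast
  have zero: "(deriv ^^ (m + 1)) H 0 = 0"
  proof (rule periodic_primitive_imp_coeff_zero[OF H_holo])
    show "(\<Phi> has_field_derivative H (nome z) / nome z ^ (m + 1)) (at z)" if "Im z > 0" for z
      using \<Phi>(1)[OF that] unfolding F_H[OF that] .
  qed (rule \<Phi>(2))
  have "H has_fps_expansion Abs_fps A * (fps_expansion B 0 * euler_quotient_fps (m * 8) (m * 16))"
    unfolding H_def E_def
  proof (intro has_fps_expansion_mult has_fps_expansion_euler_quotient)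
    show "eval_fps (Abs_fps A) has_fps_expansion Abs_fps A"
      by (intro eval_fps_has_fps_expansion less_le_trans[OF _ radius]) simp
    show "B has_fps_expansion fps_expansion B 0"
      by (rule has_fps_expansion_fps_expansion[of "ball 0 1"]) (use B_holo in auto)
  qed
  from fps_nth_fps_expansion[OF this, of "m + 1"] zero show ?thesis by simp
qed

lemma fps_mult_nth_sparse:
  fixes A :: "nat \<Rightarrow> 'a::comm_ring_1"
  assumes "\<And>n. 1 \<le> n \<Longrightarrow> n \<le> k \<Longrightarrow> A n = 0"
  shows "fps_nth (Abs_fps A * G) k = A 0 * fps_nth G k"
proof -
  have "fps_nth (Abs_fps A * G) k = (\<Sum>i\<in>{0..k}. if i = 0 then A 0 * fps_nth G k else 0)"
    unfolding fps_mult_nth by (rule sum.cong) (use assms in auto)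
  thus ?thesis by simp
qed

theorem theorem2p1:
  fixes h :: nat and f :: "complex \<Rightarrow> complex" and A :: "nat \<Rightarrow> complex"
  assumes "h > 0" and "even h"
    and "modular_form_Gamma0_2 h f"
    and "\<And>z. z \<in> upper_half_plane \<Longrightarrow>
           (\<lambda>n. A n * exp (2 * of_real pi * \<i> * z) ^ n) sums f z"
    and "A 0 \<noteq> 0"
  shows "\<exists>n. 1 \<le> n \<and> n \<le> r2 h \<and> A n \<noteq> 0"
proof (rule ccontr)
  assume none: "\<not> ?thesis"
  define m where "m = h div 4"
  have A: "A n = 0" if "1 \<le> n" "n \<le> m + 1" for n
    using that none by (auto simp: r2_def m_def)
  have expansion: "(\<lambda>n. A n * nome z ^ n) sums f z" if "Im z > 0" for z
    using assms(4)[of z] that by (simp add: nome_def)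
  define u where "u = euler_quotient 24 24"
  define U where "U = euler_quotient_fps 24 24"
  \<comment> \<open>The series of q^(m+1) J / X^m.\<close>
  define W where "W = euler_quotient_fps (24 + m * 8) (24 + m * 16)"
  have W: "U * euler_quotient_fps (m * 8) (m * 16) = W"
  proof (rule fps_expansion_unique_complex)
    show "(\<lambda>q. euler_quotient 24 24 q * euler_quotient (m * 8) (m * 16) q) has_fps_expansion
        U * euler_quotient_fps (m * 8) (m * 16)"
      unfolding U_def by (intro has_fps_expansion_mult has_fps_expansion_euler_quotient)
    show "(\<lambda>q. euler_quotient 24 24 q * euler_quotient (m * 8) (m * 16) q) has_fps_expansion W"
      unfolding euler_quotient_mult W_def by (rule has_fps_expansion_euler_quotient)
  qed
  have logW: "fps_X * fps_deriv W =
      (of_nat (48 + 32 * m) * sigma2_fps - of_nat (24 + 8 * m) * sigma_fps) * W"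
    unfolding W_def euler_quotient_fps_log_deriv by (simp add: algebra_simps)
  interpret W: eta_quotient_coeffs W m
    by unfold_locales (use logW in \<open>simp_all add: W_def\<close>)
  have u_holo: "u holomorphic_on ball 0 1"
    unfolding u_def by (rule euler_quotient_holomorphic)
  have u_cont: "isCont u 0"
    using holomorphic_on_imp_continuous_on[OF u_holo] by (simp add: continuous_on_eq_continuous_at)
  have u_expansion: "u has_fps_expansion U"
    unfolding u_def U_def by (rule has_fps_expansion_euler_quotient)
  have u_nz: "u q \<noteq> 0" for q by (simp add: u_def)
  show False
  proof (cases "h mod 4 = 2")
    case True
    hence wt: "h + 0 = 4 * m + 2" unfolding m_def by presburger
    have "fps_nth (Abs_fps A * (fps_expansion u 0 * euler_quotient_fps (m * 8) (m * 16))) (m + 1) = 0"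
    proof (rule constant_term_zero[OF assms(3) expansion wt u_holo])
      show "hauptmodul z = u (nome z) / nome z" for z by (simp add: hauptmodul_def u_def)
      show "hauptmodul (z / (1 - 2 * z)) = (1 - 2 * z) ^ 0 * hauptmodul z" if "Im z > 0" for z
        using hauptmodul_parabolic[OF that] by simp
      show "hauptmodul (- 1 / w) = w ^ 0 * (4096 * (nome (w / 2) / u (nome (w / 2))))" if "Im w > 0" for w
        using hauptmodul_inversion[OF that] by (simp add: u_def)
      show "isCont (\<lambda>p. 4096 * (p / u p)) 0"
        by (intro continuous_intros u_cont u_nz)
    qed auto
    moreover have "fps_expansion u 0 = U"
      using u_expansion by (rule fps_expansion_eqI)
    ultimately have "A 0 * fps_nth W (m + 1) = 0"
      by (simp add: fps_mult_nth_sparse[OF A] W)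
    thus False using assms(5) W.coeff_nonzero by simp
  next
    case False
    hence h4: "h mod 4 = 0" using \<open>even h\<close> by presburger
    hence h: "h = 4 * m" by (auto simp: m_def)
    hence wt: "h + 2 = 4 * m + 2" by simp
    \<comment> \<open>Needed at the end, where the identity for the coefficient carries the factor
      16 m.\<close>
    have "m > 0" using h assms(1) by simp
    \<comment> \<open>As J = u/q, this makes B/q equal to q dJ/dq, which is the derivative of J in z
      divided by 2 pi i.\<close>
    define B where "B = (\<lambda>q. q * deriv u q - u q)"
    have B_holo: "B holomorphic_on ball 0 1"
      unfolding B_def by (intro holomorphic_intros u_holo) auto
    define g where "g = (\<lambda>z. B (nome z) / nome z)"
    have du: "(u has_field_derivative deriv u q) (at q)" if "norm q < 1" for q
      using holomorphic_derivI[OF u_holo open_ball, of q] that by simp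
    have dJ: "(hauptmodul has_field_derivative 2 * of_real pi * \<i> * g z) (at z)" if "Im z > 0" for z
    proof -
      from du[OF norm_nome_less_1[OF that]] DERIV_chain2[OF _ has_field_derivative_nome]
      have "((\<lambda>z. u (nome z)) has_field_derivative deriv u (nome z) * (2 * of_real pi * \<i> * nome z)) (at z)"
        by blast
      note DERIV_divide[OF this has_field_derivative_nome nome_nonzero]
      moreover have "(d * (c * q) * q - w * (c * q)) / (q * q) = c * ((q * d - w) / q)"
        if "q \<noteq> 0" for c d q w :: complex
        using that by (simp add: divide_simps) (simp add: algebra_simps)
      ultimately show ?thesis
        by (simp only: nome_nonzero not_False_eq_True hauptmodul_def [abs_def] u_def [symmetric] g_def B_def)
    qed
    \<comment> \<open>At the cusp 0, J is 4096 k(nome(w/2)). Differentiating nome(w/2) brings a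
      factor 1/2, hence the 2048 below.\<close>
    define k where "k = (\<lambda>p. p / u p)"
    have k_holo: "k holomorphic_on ball 0 1"
      unfolding k_def by (intro holomorphic_intros u_holo) (auto simp: u_nz)
    have dk: "(k has_field_derivative deriv k q) (at q)" if "norm q < 1" for q
      using holomorphic_derivI[OF k_holo open_ball, of q] that by simp
    have "fps_nth (Abs_fps A * (fps_expansion B 0 * euler_quotient_fps (m * 8) (m * 16))) (m + 1) = 0"
    proof (rule constant_term_zero[OF assms(3) expansion wt B_holo])
      show "g z = B (nome z) / nome z" for z by (simp add: g_def)
      show "g (z / (1 - 2 * z)) = (1 - 2 * z)\<^sup>2 * g z" if "Im z > 0" for z
      proof -
        note z = parabolic_conj(3,7)[OF that]
        have "((\<lambda>z. z / (1 - 2 * z)) has_field_derivative 1 / (1 - 2 * z)\<^sup>2) (at z)"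
          using z by (auto intro!: derivative_eq_intros simp: power2_eq_square algebra_simps)
        from DERIV_chain2[OF dJ[OF z(2)] this]
        have "((\<lambda>z. hauptmodul (z / (1 - 2 * z))) has_field_derivative
            2 * of_real pi * \<i> * g (z / (1 - 2 * z)) * (1 / (1 - 2 * z)\<^sup>2)) (at z)" .
        hence "(hauptmodul has_field_derivative
            2 * of_real pi * \<i> * g (z / (1 - 2 * z)) * (1 / (1 - 2 * z)\<^sup>2)) (at z)"
          by (rule has_field_derivative_transform_within_open[OF _ open_upper_half_plane])
             (use that hauptmodul_parabolic in auto)
        from DERIV_unique[OF this dJ[OF that]] show ?thesis using z by (simp add: field_simps)
      qed
      show "g (- 1 / w) = w\<^sup>2 * (2048 * (nome (w / 2) * deriv k (nome (w / 2))))" if "Im w > 0" for w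
      proof -
        have w0: "w \<noteq> 0" using that by auto
        have "((\<lambda>w. - 1 / w) has_field_derivative 1 / w\<^sup>2) (at w)"
          using w0 by (auto intro!: derivative_eq_intros simp: power2_eq_square)
        from DERIV_chain2[OF dJ[OF Im_inversion_pos[OF that]] this]
        have 1: "((\<lambda>w. hauptmodul (- 1 / w)) has_field_derivative
            2 * of_real pi * \<i> * g (- 1 / w) * (1 / w\<^sup>2)) (at w)" .
        have "Im (w / 2) > 0" using that by simp
        note p = norm_nome_less_1[OF this]
        have "((\<lambda>w. w / 2) has_field_derivative 1 / 2) (at w)"
          by (auto intro!: derivative_eq_intros)
        from DERIV_chain2[OF dk[OF p] DERIV_chain2[OF has_field_derivative_nome this]]
        have "((\<lambda>w. 4096 * k (nome (w / 2))) has_field_derivative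
            4096 * (deriv k (nome (w / 2)) * (2 * of_real pi * \<i> * nome (w / 2) * (1 / 2)))) (at w)"
          by (rule DERIV_cmult)
        hence "((\<lambda>w. hauptmodul (- 1 / w)) has_field_derivative
            4096 * (deriv k (nome (w / 2)) * (2 * of_real pi * \<i> * nome (w / 2) * (1 / 2)))) (at w)"
          by (rule has_field_derivative_transform_within_open[OF _ open_upper_half_plane])
             (use that hauptmodul_inversion in \<open>auto simp: k_def u_def\<close>)
        from DERIV_unique[OF 1 this] show ?thesis using w0 by (simp add: field_simps)
      qed
      have "deriv k holomorphic_on ball 0 1" by (intro holomorphic_deriv k_holo) auto
      hence "isCont (deriv k) 0"
        using holomorphic_on_imp_continuous_on by (fastforce simp: continuous_on_eq_continuous_at)
      thus "isCont (\<lambda>p. 2048 * (p * deriv k p)) 0" by (intro continuous_intros)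
    qed auto
    moreover have "fps_expansion B 0 = fps_X * fps_deriv U - U"
      unfolding B_def by (rule fps_expansion_eqI) (intro fps_expansion_intros u_expansion)
    ultimately have "A 0 * fps_nth ((fps_X * fps_deriv U - U) * euler_quotient_fps (m * 8) (m * 16)) (m + 1) = 0"
      by (simp add: fps_mult_nth_sparse[OF A])
    moreover have dU: "fps_X * fps_deriv U = (of_nat 48 * sigma2_fps - of_nat 24 * sigma_fps) * U"
      unfolding U_def euler_quotient_fps_log_deriv by simp
    have "(fps_X * fps_deriv U - U) * euler_quotient_fps (m * 8) (m * 16) =
        (of_nat 48 * sigma2_fps - of_nat 24 * sigma_fps - 1) * W"
      unfolding W [symmetric] dU by (simp add: algebra_simps)
    moreover define Z where "Z = (of_nat 48 * sigma2_fps - of_nat 24 * sigma_fps - 1) * W"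
    ultimately have zero: "fps_nth Z (m + 1) = 0"
      using assms(5) by simp
    \<comment> \<open>The integration by parts: in degree m + 1 the operator q d/dq multiplies by m
      + 1, so the unknown coefficient of \<open>W\<close> cancels, and what is left of
      \<open>sigma2_fps\<close> and \<open>sigma_fps\<close> has coefficients 16 m and -16
      m.\<close>
    have "of_nat (16 * m) * ((sigma2_fps - sigma_fps) * W) =
        of_nat (m + 1) * Z + of_nat (m + 1) * W - fps_X * fps_deriv W"
      unfolding logW Z_def by (simp add: algebra_simps)
    hence "fps_nth (of_nat (16 * m) * ((sigma2_fps - sigma_fps) * W)) (m + 1) =
        fps_nth (of_nat (m + 1) * Z + of_nat (m + 1) * W - fps_X * fps_deriv W) (m + 1)"
      by (rule arg_cong)
    hence "of_nat (16 * m) * fps_nth ((sigma2_fps - sigma_fps) * W) (m + 1) = (0 :: complex)"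
      unfolding fps_of_nat [symmetric] fps_sub_nth fps_add_nth fps_mult_left_const_nth
      using zero by simp
    thus False using W.sigma_diff_mult_coeff_nonzero \<open>m > 0\<close> by simp
  qed
qed

end
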